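(* Let $n \geq 2k-2$. Then, for every cover of $\mathbb{S}^n$ by $k$ open sets, one of the sets contains an antipodally connecting path. The bound $n \geq 2k-2$ is sharp, in the sense that the statement fails for $n < 2k-2$: whenever $n < 2k-2$, there is a cover of $\mathbb{S}^n$ by $k$ open sets such that none of the sets contains an antipodally connecting path.
   Context: Here $k$ (the number of sets in the cover) and $n$ (the dimension of the sphere) are integers, and $\mathbb{S}^n = \{x \in \mathbb{R}^{n+1} : \|x\|_2 = 1\}$ is the unit sphere with its usual topology; open means open in $\mathbb{S}^n$. The antipode of $x \in \mathbb{S}^n$ is $-x$. A set $U \subset \mathbb{S}^n$ contains an antipodally connecting path if there exists a path in $U$ connecting two antipodal points, i.e. there is a continuous map $\gamma : [0,1] \to \mathbb{S}^n$ with $\gamma([0,1]) \subseteq U$ and $\gamma(1) = -\gamma(0)$.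
   Formalization: The first claim is stated only for n ≥ 1: for n = 0, k = 1 it is false, since S^0 = {1, -1} covers itself and no path in it joins 1 to -1. Sharpness is stated for all n ≥ 0. *)

theory Defs
  imports "HOL-Analysis.Analysis"
begin

text \<open>
  The sphere of dimension \<open>n\<close> is the library's \<^const>\<open>nsphere\<close> \<open>n\<close>: its points are the
  sequences \<open>x :: nat \<Rightarrow> real\<close> that vanish beyond index \<open>n\<close> and satisfy
  \<open>(\<Sum>i\<le>n. x i ^ 2) = 1\<close>, with the topology inherited from the product topology. The dimension
  is thus an ordinary natural number. Sequences have no unary minus without further imports, hence
  the explicit antipode.
\<close>

definition antipode :: "(nat \<Rightarrow> real) \<Rightarrow> nat \<Rightarrow> real" where
  "antipode x = (\<lambda>i. - x i)"

definition contains_antipodally_connecting_path :: "nat \<Rightarrow> (nat \<Rightarrow> real) set \<Rightarrow> bool" where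
  "contains_antipodally_connecting_path n U \<longleftrightarrow>
     (\<exists>\<gamma>. pathin (nsphere n) \<gamma> \<and> \<gamma> ` {0..1} \<subseteq> U \<and> \<gamma> 1 = antipode (\<gamma> 0))"

text \<open>
  A cover by \<open>k\<close> sets is an indexed family, so members may repeat or be empty; \<open>U i\<close> for
  \<open>i \<ge> k\<close> is irrelevant.
\<close>

definition open_cover_of_sphere :: "nat \<Rightarrow> nat \<Rightarrow> (nat \<Rightarrow> (nat \<Rightarrow> real) set) \<Rightarrow> bool" where
  "open_cover_of_sphere n k U \<longleftrightarrow>
     (\<forall>i<k. openin (nsphere n) (U i)) \<and> (\<Union>i<k. U i) = topspace (nsphere n)"

end

theory Submission imports Defs "HOL-Library.Z2" begin

text \<open>
  Put \<open>d = k - 1\<close>.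

  \<^bold>\<open>Some set contains a path when \<open>n \<ge> 2 * d\<close>.\<close> Suppose none does. Give every point a colour, the
  index of a set of the cover that contains a ball of fixed radius around it, and a label, this
  colour together with the path component of the point in that set. Close points of equal colour
  have equal labels, so a small simplex carries at most \<open>d + 1\<close> labels, and the labelling behaves
  like a map \<open>f\<close> into a complex of dimension \<open>d\<close>, the nerve of all the components. As a component
  contains no antipodal pair, \<open>f x\<close> and \<open>f (-x)\<close> always lie in disjoint simplices. Map the complex
  to \<open>2 * d\<close> dimensions by a map \<open>g\<close> that sends its vertices to the moment curve, and count modulo
  2 the zeros of the odd map \<open>g (f x) - g (f (-x))\<close> on a \<open>2 * d\<close>-sphere. By Borsuk-Ulam the number
  of antipodal pairs of zeros is odd. On the other hand a zero arises from two disjoint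
  \<open>d\<close>-simplices \<open>\<sigma>\<close>, \<open>\<tau>\<close> whose vertices alternate along the curve, and for fixed \<open>\<sigma>\<close>, \<open>\<tau>\<close> the
  zeros with \<open>f x\<close> in \<open>\<sigma>\<close> and \<open>f (-x)\<close> in \<open>\<tau>\<close> are the intersection points of two \<open>d\<close>-cycles. Such
  cycles bound, so their number is even.

  The proof below is the chain-level form of this argument. Chains modulo 2 are formed from tuples
  of points of the sphere that are close to each other, with no continuity and no triangulation.
  The one topological input is \<open>sphere_filling\<close>: small cycles of dimension below \<open>n\<close> bound small
  chains. The odd number comes from cochains \<open>\<Phi>\<^sub>p\<close> with \<open>\<delta> \<Phi>\<^sub>p = \<Phi>\<^sub>p\<^sub>+\<^sub>1 + \<Phi>\<^sub>p\<^sub>+\<^sub>1 \<circ> T\<close> for the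
  antipodal involution \<open>T\<close> (\<open>coboundary_index_cochain\<close>): evaluated along chains \<open>e\<^sub>p\<close> with \<open>\<partial>
  e\<^sub>p\<^sub>+\<^sub>1 = e\<^sub>p + T e\<^sub>p\<close>, the half-spheres, they show that \<open>\<Phi>\<^sub>p\<close> is 1 on the sphere \<open>e\<^sub>p + T e\<^sub>p\<close>
  (\<open>index_cycle\<close>). The even number is \<open>intersection_zero\<close>, for \<open>p = 2 * d\<close>.

  Alternation along a curve is a determinant: for \<open>a\<close>, \<open>b\<close> of equal length, the matrix with
  entries \<open>[a\<^sub>i < b\<^sub>j]\<close> has odd determinant exactly if the entries can be ordered so that \<open>a\<^sub>0 <
  b\<^sub>0 < a\<^sub>1 < b\<^sub>1 < \<dots>\<close>. The coboundary formula for the \<open>\<Phi>\<^sub>p\<close> then becomes linear algebra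
  (\<open>coboundary_coboundary_permanent\<close>).

  \<^bold>\<open>A cover without such paths when \<open>n < 2 * d\<close>.\<close> Group the coordinates into \<open>d\<close> pairs. Folding a
  plane onto an infinite tripod, a tree with three rays, separates \<open>z\<close> from \<open>-z\<close> for \<open>z \<noteq> 0\<close>, so
  the product of \<open>d\<close> foldings maps the sphere to a complex of dimension \<open>d\<close> without identifying
  antipodes. The \<open>d + 1\<close> sets are made of the points that are, in this complex, close to cells of
  a given dimension; see \<open>sharp_cover\<close>.
\<close>

section \<open>Deletion sums and coboundaries modulo 2\<close>

text \<open>
  The default rules turn sums and products of bits into bitwise operations and case distinctions
  on values. Here bits are scalars, and their sums have to stay sums.
\<close>

declare add_bit_eq_xor [simp del] mult_bit_eq_and [simp del]

lemma bit_double [simp]: "(a::bit) + a = 0"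
  by (cases a) auto

lemma bit_left_double [simp]: "(a::bit) + (a + b) = b"
  by (simp flip: add.assoc)

lemma bit_eqI: "(a::bit) + b = 0 \<Longrightarrow> a = b"
  by (cases a; cases b) auto

text \<open>
  The sum of \<open>f\<close> over the lists that arise from \<open>s\<close> by deleting one entry, weighted by a function
  of the deleted entry. Weight 1 gives the simplicial coboundary; the entries of a matrix row as
  weights give Laplace expansion along this row.
\<close>

primrec deletion_sum :: "('a \<Rightarrow> bit) \<Rightarrow> ('a list \<Rightarrow> bit) \<Rightarrow> 'a list \<Rightarrow> bit" where
  "deletion_sum w f [] = 0"
| "deletion_sum w f (x # s) = w x * f s + deletion_sum w (\<lambda>t. f (x # t)) s"

abbreviation coboundary :: "('a list \<Rightarrow> bit) \<Rightarrow> 'a list \<Rightarrow> bit" where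
  "coboundary \<equiv> deletion_sum (\<lambda>_. 1)"

lemma deletion_sum_add: "deletion_sum w (\<lambda>t. f t + g t) s = deletion_sum w f s + deletion_sum w g s"
  by (induction s arbitrary: f g) (simp_all add: algebra_simps)

lemma deletion_sum_add_weight: "deletion_sum (\<lambda>y. v y + w y) f s = deletion_sum v f s
    + deletion_sum w f s"
  by (induction s arbitrary: f) (simp_all add: algebra_simps)

lemma deletion_sum_mult: "deletion_sum w (\<lambda>t. c * f t) s = c * deletion_sum w f s"
  by (induction s arbitrary: f) (simp_all add: algebra_simps)

lemma deletion_sum_mult_right: "deletion_sum w (\<lambda>t. f t * c) s = deletion_sum w f s * c"
  using deletion_sum_mult[of w c f s] by (simp add: mult.commute)

lemma deletion_sum_zero [simp]: "deletion_sum w (\<lambda>t. 0) s = 0"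
  by (induction s) simp_all

lemma deletion_sum_cong:
  assumes "\<And>x. x \<in> set s \<Longrightarrow> w x = v x"
    and "\<And>t. length s = Suc (length t) \<Longrightarrow> set t \<subseteq> set s \<Longrightarrow> f t = g t"
  shows "deletion_sum w f s = deletion_sum v g s"
  using assms
proof (induction s arbitrary: f g)
  case (Cons x s)
  have "deletion_sum w (\<lambda>t. f (x # t)) s = deletion_sum v (\<lambda>t. g (x # t)) s"
    by (rule Cons.IH) (use Cons.prems in \<open>auto intro!: Cons.prems(2)\<close>)
  moreover have "f s = g s" by (rule Cons.prems(2)) auto
  ultimately show ?case using Cons.prems(1)[of x] by simp
qed simp

lemma deletion_sum_commute: "deletion_sum v (deletion_sum w f) s = deletion_sum w (deletion_sum v f) s"
  by (induction s arbitrary: f) (simp_all add: deletion_sum_add deletion_sum_mult deletion_sum_mult_right algebra_simps)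

text \<open>
  Two entries are deleted in either order with the same weight, so all terms cancel in pairs. With
  weight 1 this is \<open>\<delta> \<circ> \<delta> = 0\<close>; in general it makes a permanent with two equal rows vanish.
\<close>

lemma deletion_sum_square [simp]: "deletion_sum w (deletion_sum w f) s = 0"
  by (induction s arbitrary: f) (simp_all add: deletion_sum_add deletion_sum_mult deletion_sum_mult_right algebra_simps)

lemma deletion_sum_swap: "deletion_sum v (\<lambda>c. deletion_sum w (f c) b) a
    = deletion_sum w (\<lambda>d. deletion_sum v (\<lambda>c. f c d) a) b"
  by (induction a arbitrary: f) (simp_all add: deletion_sum_add deletion_sum_mult)

lemma deletion_sum_map: "deletion_sum w f (map h s) = deletion_sum (\<lambda>x. w (h x)) (\<lambda>t. f (map h t)) s"
  by (induction s arbitrary: f) simp_all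

lemma deletion_sum_append:
  "deletion_sum w f (s @ t) = deletion_sum w (\<lambda>u. f (u @ t)) s + deletion_sum w (\<lambda>u. f (s @ u)) t"
  by (induction s arbitrary: f) simp_all

lemma deletion_sum_rev: "deletion_sum w f (rev s) = deletion_sum w (\<lambda>t. f (rev t)) s"
  by (induction s arbitrary: f) (simp_all add: deletion_sum_append)

lemma deletion_sum_perm:
  assumes sym: "\<And>s t. mset s = mset t \<Longrightarrow> f s = f t" and "mset s = mset t"
  shows "deletion_sum w f s = deletion_sum w f t"
  using assms
proof (induction s arbitrary: f t)
  case (Cons x s)
  then obtain u v where t: "t = u @ x # v"
    by (metis in_multiset_in_set split_list union_single_eq_member mset.simps(2))
  with Cons.prems have uv: "mset s = mset (u @ v)" by simp
  have "deletion_sum w (\<lambda>r. f (x # r)) s = deletion_sum w (\<lambda>r. f (x # r)) (u @ v)"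
    by (rule Cons.IH) (use uv in \<open>auto intro: Cons.prems(1)\<close>)
  moreover have "f s = f (u @ v)" by (rule Cons.prems(1)[OF uv])
  moreover have "f (r @ x # v) = f (x # r @ v)" "f (u @ x # r) = f (x # u @ r)" for r
    by (rule Cons.prems(1); simp)+
  ultimately show ?case by (simp add: t deletion_sum_append algebra_simps)
qed simp

text \<open>
  If an entry occurs twice, only the deletion of one or the other occurrence can leave a distinct
  list, and both deletions leave the same entries. This is how a cochain on tuples of labels
  becomes a cocycle in degrees where labels must repeat.
\<close>

lemma coboundary_alternating_nondistinct:
  assumes sym: "\<And>s t. mset s = mset t \<Longrightarrow> f s = f t"
    and alt: "\<And>s. \<not> distinct s \<Longrightarrow> f s = 0"
    and "\<not> distinct s"
  shows "coboundary f s = 0"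
proof -
  obtain u x v y where s: "s = u @ [x] @ v @ [x] @ y"
    using not_distinct_decomp[OF assms(3)] by metis
  have "coboundary f s = coboundary f (x # x # u @ v @ y)"
    by (rule deletion_sum_perm[OF sym]) (auto simp: s)
  also have "\<dots> = coboundary (\<lambda>t. f (x # x # t)) (u @ v @ y)" by simp
  also have "\<dots> = coboundary (\<lambda>t. 0) (u @ v @ y)" by (rule deletion_sum_cong) (auto simp: alt)
  finally show ?thesis by simp
qed

text \<open>
  Leibniz rule for the cup product, with a kernel \<open>K\<close> in place of a product of two cochains. The
  right-hand side contains two terms that are absent on the left: the deletion of the last entry
  of the front part and of the first entry of the back part. They are equal, hence cancel modulo
  2.
\<close>

lemma coboundary_kernel:
  assumes "Suc p < length s"
  shows "coboundary (\<lambda>u. K (take (Suc p) u) (drop p u)) s =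
    coboundary (\<lambda>a. K a (drop (Suc p) s)) (take (Suc (Suc p)) s) +
    coboundary (\<lambda>b. K (take (Suc p) s) b) (drop p s)"
  using assms
proof (induction p arbitrary: K s)
  case 0
  then obtain x y r where "s = x # y # r"
    by (cases s; cases "tl s") auto
  then show ?case by (simp add: algebra_simps)
next
  case (Suc p)
  then obtain x r where s: "s = x # r" by (cases s) auto
  have "Suc p < length r" using Suc.prems s by simp
  from Suc.IH[OF this, of "\<lambda>a b. K (x # a) b"] show ?case
    by (simp add: s algebra_simps)
qed

section \<open>The alternation form\<close>

text \<open>
  The permanent, over the field with two elements equal to the determinant, of the matrix with
  entries \<open>[R (a ! i) (b ! j)]\<close>; it is 0 unless the lists have equal length.
\<close>

primrec permanent :: "('a \<Rightarrow> 'a \<Rightarrow> bool) \<Rightarrow> 'a list \<Rightarrow> 'a list \<Rightarrow> bit" where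
  "permanent R [] = (\<lambda>b. of_bool (b = []))"
| "permanent R (x # a) = deletion_sum (\<lambda>y. of_bool (R x y)) (permanent R a)"

text \<open>
  Laplace expansion along the first column, whereas the definition expands along the first row.
\<close>

lemma permanent_column: "permanent R b (x # a)
    = deletion_sum (\<lambda>y. of_bool (R y x)) (\<lambda>c. permanent R c a) b"
proof (induction b arbitrary: a)
  case (Cons y b)
  have "deletion_sum (\<lambda>z. of_bool (R y z)) (\<lambda>c. permanent R b (x # c)) a =
        deletion_sum (\<lambda>z. of_bool (R y z))
            (\<lambda>c. deletion_sum (\<lambda>y. of_bool (R y x)) (\<lambda>d. permanent R d c) b) a"
    by (simp add: Cons.IH)
  also have "\<dots> = deletion_sum (\<lambda>y. of_bool (R y x))
      (\<lambda>d. deletion_sum (\<lambda>z. of_bool (R y z)) (permanent R d) a) b" 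
    by (rule deletion_sum_swap)
  finally show ?case by simp
qed simp

lemma permanent_transpose: "permanent R b a = permanent (\<lambda>x y. R y x) a b"
  by (induction a arbitrary: b) (auto simp: permanent_column gr0_conv_Suc neq_Nil_conv
      cong: deletion_sum_cong)

lemma permanent_perm_left:
  assumes "mset a = mset a'"
  shows "permanent R a b = permanent R a' b"
  using assms
proof (induction a arbitrary: a' b)
  case (Cons x a)
  have front: "permanent R (u @ x # v) b = permanent R (x # u @ v) b" for u v b
  proof (induction u arbitrary: b)
    case (Cons y u)
    then have "permanent R (u @ x # v) = permanent R (x # u @ v)" by blast
    then show ?case by (simp add: deletion_sum_commute[of "\<lambda>z. of_bool (R y z)"])
  qed simp
  from Cons.prems obtain u v where a': "a' = u @ x # v"
    by (metis in_multiset_in_set split_list union_single_eq_member mset.simps(2))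
  with Cons.prems have "mset a = mset (u @ v)" by simp
  then have "permanent R a = permanent R (u @ v)" using Cons.IH by blast
  then show ?case by (simp only: a' front permanent.simps)
qed simp

lemma permanent_perm_right: "mset b = mset b' \<Longrightarrow> permanent R a b = permanent R a b'"
  using permanent_perm_left[of b b'] by (simp add: permanent_transpose[of R a])

lemma permanent_nondistinct_left:
  assumes "\<not> distinct a" shows "permanent R a b = 0"
proof -
  obtain u x v y where a: "a = u @ [x] @ v @ [x] @ y"
    using not_distinct_decomp[OF assms] by metis
  have "permanent R a b = permanent R (x # x # u @ v @ y) b"
    by (rule permanent_perm_left) (simp add: a)
  then show ?thesis by simp
qed

lemma permanent_nondistinct_right: "\<not> distinct b \<Longrightarrow> permanent R a b = 0"
  using permanent_nondistinct_left by (metis permanent_transpose)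

text \<open>
  For distinct labels \<open>R y x = 1 + R x y\<close>, so \<open>permanent R b a\<close> is, up to transposition, the
  determinant of \<open>M + J\<close>, where \<open>M\<close> is the matrix of \<open>permanent R a b\<close> and \<open>J\<close> has all entries 1.
  As \<open>J\<close> has rank one, \<open>det (M + J) - det M\<close> is the sum of all cofactors of \<open>M\<close>, which is the
  double deletion sum on the left. The induction expands along the first entry of \<open>a\<close>.
\<close>

lemma coboundary_coboundary_permanent:
  assumes "length a = length b"
    and "\<And>x y. x \<in> set a \<Longrightarrow> y \<in> set b \<Longrightarrow> R x y \<noteq> R y x"
  shows "coboundary (\<lambda>c. coboundary (permanent R c) b) a = permanent R a b + permanent R b a"
  using assms
proof (induction a arbitrary: b)
  case (Cons x a)
  let ?w = "\<lambda>y. of_bool (R x y)"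
  have IH: "coboundary (\<lambda>c. coboundary (permanent R c) d) a = permanent R a d + permanent R d a"
    if "length b = Suc (length d)" "set d \<subseteq> set b" for d
    using that Cons.prems by (intro Cons.IH) auto
  have "coboundary (\<lambda>c. coboundary (permanent R (x # c)) b) a
      = coboundary (\<lambda>c. deletion_sum ?w (coboundary (permanent R c)) b) a"
    by (simp add: deletion_sum_commute[of "\<lambda>_. 1" ?w])
  also have "\<dots> = deletion_sum ?w (\<lambda>d. coboundary (\<lambda>c. coboundary (permanent R c) d) a) b"
    by (rule deletion_sum_swap)
  also have "\<dots> = deletion_sum ?w (\<lambda>d. permanent R a d + permanent R d a) b"
    by (rule deletion_sum_cong) (use IH in auto)
  finally have 1: "coboundary (\<lambda>c. coboundary (permanent R (x # c)) b) a = permanent R (x # a) b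
      + deletion_sum ?w (\<lambda>d. permanent R d a) b"
    by (simp add: deletion_sum_add)
  have "coboundary (\<lambda>d. permanent R a d + permanent R d a) b
      = coboundary (\<lambda>d. coboundary (\<lambda>c. coboundary (permanent R c) d) a) b"
    by (rule deletion_sum_cong) (use IH in auto)
  also have "\<dots> = coboundary (\<lambda>c. coboundary (coboundary (permanent R c)) b) a"
      by (rule deletion_sum_swap)
  also have "\<dots> = 0" by simp
  finally have 2: "coboundary (permanent R a) b = coboundary (\<lambda>d. permanent R d a) b"
    unfolding deletion_sum_add by (rule bit_eqI)
  have "permanent R b (x # a) = deletion_sum (\<lambda>y. 1 + ?w y) (\<lambda>d. permanent R d a) b"
    unfolding permanent_column by (rule deletion_sum_cong) (use Cons.prems(2)[of x] in auto)
  also have "\<dots> = coboundary (permanent R a) b + deletion_sum ?w (\<lambda>d. permanent R d a) b"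
    by (simp add: deletion_sum_add_weight 2)
  finally show ?case using 1 by (simp add: algebra_simps)
qed simp

text \<open>
  Apply one further coboundary to the formula \<open>\<delta>\<^sub>a \<delta>\<^sub>b M = M + M\<^sup>T\<close>: the left-hand side vanishes
  by \<open>\<delta>\<^sub>b \<delta>\<^sub>b = 0\<close>.
\<close>

lemma coboundary_permanent_transpose:
  assumes "length b = Suc (length a)"
    and "\<And>x y. x \<in> set a \<Longrightarrow> y \<in> set b \<Longrightarrow> R x y \<noteq> R y x"
  shows "coboundary (permanent R a) b = coboundary (\<lambda>d. permanent R d a) b"
proof -
  have "coboundary (\<lambda>d. permanent R a d + permanent R d a) b
      = coboundary (\<lambda>d. coboundary (\<lambda>c. coboundary (permanent R c) d) a) b"
    by (rule deletion_sum_cong) (use assms in \<open>auto simp: coboundary_coboundary_permanent subset_iff\<close>)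
  also have "\<dots> = coboundary (\<lambda>c. coboundary (coboundary (permanent R c)) b) a"
    by (rule deletion_sum_swap)
  also have "\<dots> = 0" by simp
  finally show ?thesis unfolding deletion_sum_add by (rule bit_eqI)
qed

section \<open>Chains of tuples modulo 2\<close>

text \<open>
  The only face of a one-point tuple is the empty tuple. This makes the chain complex augmented,
  so that its homology is reduced homology.
\<close>

primrec faces :: "'a list \<Rightarrow> 'a list list" where
  "faces [] = []"
| "faces (x # s) = s # map ((#) x) (faces s)"

definition pairing :: "('a list \<Rightarrow> bit) \<Rightarrow> 'a list list \<Rightarrow> bit" where
  "pairing f C = sum_list (map f C)"

definition boundary :: "'a list list \<Rightarrow> 'a list list" where
  "boundary C = concat (map faces C)"

text \<open>
  A chain is a list of tuples, with repetitions. Two lists present the same chain modulo 2 if no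
  cochain distinguishes them; a cycle is then a chain \<open>C\<close> with \<open>boundary C \<simeq> []\<close>. All identities
  between chains reduce in this way to identities between cochains on single tuples.
\<close>

definition equal_mod2 :: "'a list list \<Rightarrow> 'a list list \<Rightarrow> bool" (infix "\<simeq>" 50) where
  "C \<simeq> D \<longleftrightarrow> (\<forall>f. pairing f C = pairing f D)"

lemma pairing_simps [simp]:
  "pairing f [] = 0" "pairing f (s # C) = f s + pairing f C" "pairing f (C @ D) = pairing f C
      + pairing f D"
  "pairing (\<lambda>s. 0) C = 0"
  by (simp_all add: pairing_def)

lemma pairing_map: "pairing f (map g C) = pairing (\<lambda>s. f (g s)) C"
  by (simp add: pairing_def o_def)

lemma pairing_add: "pairing (\<lambda>s. f s + g s) C = pairing f C + pairing g C"
  by (induction C) (simp_all add: algebra_simps)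

lemma pairing_cong: "(\<And>s. s \<in> set C \<Longrightarrow> f s = g s) \<Longrightarrow> pairing f C = pairing g C"
  by (induction C) auto

lemma pairing_concat_map: "pairing f (concat (map g C)) = pairing (\<lambda>s. pairing f (g s)) C"
  by (induction C) auto

lemma pairing_filter: "pairing f (filter P C) = pairing (\<lambda>s. if P s then f s else 0) C"
  by (induction C) auto

lemma pairing_partition: "pairing f C = pairing f (filter P C) + pairing f (filter (\<lambda>s. \<not> P s) C)"
  by (induction C) (auto simp: algebra_simps)

lemma pairing_faces: "pairing f (faces s) = coboundary f s"
  by (induction s arbitrary: f) (auto simp: pairing_map)

lemma pairing_boundary: "pairing f (boundary C) = pairing (coboundary f) C"
  by (simp add: boundary_def pairing_concat_map pairing_faces)

lemma pairing_coboundary_coboundary [simp]: "pairing (coboundary (coboundary f)) C = 0"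
  by (induction C) simp_all

lemma faces_map: "faces (map h s) = map (map h) (faces s)"
  by (induction s) auto

lemma faces_subset: "t \<in> set (faces s) \<Longrightarrow> set t \<subseteq> set s \<and> length s = Suc (length t)"
proof (induction s arbitrary: t)
  case (Cons x s)
  show ?case
  proof (cases "t = s")
    case False
    with Cons.prems obtain u where u: "u \<in> set (faces s)" "t = x # u" by auto
    then show ?thesis using Cons.IH[OF u(1)] by auto
  qed auto
qed simp

lemma boundary_map: "boundary (map (map h) C) = map (map h) (boundary C)"
  by (induction C) (auto simp: boundary_def faces_map)

lemma boundary_append: "boundary (C @ D) = boundary C @ boundary D"
  by (simp add: boundary_def)

text \<open>
  The usual decomposition of a prism into the simplices \<open>g x\<^sub>0, \<dots>, g x\<^sub>j, h x\<^sub>j, \<dots>, h x\<^sub>p\<close>.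
\<close>

primrec prism :: "('a \<Rightarrow> 'b) \<Rightarrow> ('a \<Rightarrow> 'b) \<Rightarrow> 'a list \<Rightarrow> 'b list list" where
  "prism g h [] = []"
| "prism g h (x # s) = (g x # map h (x # s)) # map ((#) (g x)) (prism g h s)"

lemma prism_elem:
  "t \<in> set (prism g h s) \<Longrightarrow> length t = Suc (length s) \<and> set t \<subseteq> g ` set s \<union> h ` set s"
proof (induction s arbitrary: t)
  case (Cons x s)
  show ?case
  proof (cases "t = g x # map h (x # s)")
    case False
    with Cons.prems obtain u where u: "u \<in> set (prism g h s)" "t = g x # u" by auto
    then show ?thesis using Cons.IH[OF u(1)] by auto
  qed auto
qed simp

text \<open>
  The prism operator is a chain homotopy between \<open>g\<close> and \<open>h\<close>, stated for the pairing with one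
  cochain.
\<close>

lemma pairing_prism:
  "pairing (coboundary f) (prism g h s) + coboundary (\<lambda>t. pairing f (prism g h t)) s = f (map g s)
      + f (map h s)"
proof (induction s arbitrary: f)
  case (Cons x s)
  have "pairing (coboundary f) (prism g h (x # s)) + coboundary (\<lambda>t. pairing f (prism g h t)) (x # s)
      = f (map h (x # s)) + f (g x # map h s)
        + (pairing (coboundary (\<lambda>t. f (g x # t))) (prism g h s)
           + coboundary (\<lambda>t. pairing (\<lambda>t. f (g x # t)) (prism g h t)) s)"
    by (simp add: pairing_add pairing_map deletion_sum_add deletion_sum_map algebra_simps)
  also have "\<dots> = f (map g (x # s)) + f (map h (x # s))"
    unfolding Cons.IH by (simp add: algebra_simps)
  finally show ?case .
qed simp

definition prisms :: "('a \<Rightarrow> 'b) \<Rightarrow> ('a \<Rightarrow> 'b) \<Rightarrow> 'a list list \<Rightarrow> 'b list list" where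
  "prisms g h C = concat (map (prism g h) C)"

lemma boundary_prisms:
  assumes "boundary C \<simeq> []"
  shows "pairing f (boundary (prisms g h C)) = pairing f (map (map g) C) + pairing f (map (map h) C)"
proof -
  let ?P = "\<lambda>t. pairing f (prism g h t)"
  have zero: "pairing (coboundary ?P) C = 0"
    using assms unfolding equal_mod2_def pairing_boundary by simp
  have "pairing f (boundary (prisms g h C)) = pairing (\<lambda>s. pairing (coboundary f) (prism g h s)) C
      + pairing (coboundary ?P) C"
    unfolding zero by (simp add: pairing_boundary prisms_def pairing_concat_map)
  also have "\<dots> = pairing (\<lambda>s. f (map g s) + f (map h s)) C"
    unfolding pairing_add[symmetric] pairing_prism ..
  finally show ?thesis by (simp add: pairing_add pairing_map)
qed

lemma boundary_cone: "pairing f (boundary (map ((#) p) C)) = pairing f C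
    + pairing (\<lambda>t. f (p # t)) (boundary C)"
  by (simp add: pairing_boundary pairing_add pairing_map)

section \<open>Filling small cycles in the sphere\<close>

text \<open>
  The supremum distance does not mention the number of coordinates, so that spheres of different
  dimensions share one notion of a small tuple.
\<close>

definition nearby :: "real \<Rightarrow> (nat \<Rightarrow> real) \<Rightarrow> (nat \<Rightarrow> real) \<Rightarrow> bool" where
  "nearby \<epsilon> x y \<longleftrightarrow> (\<forall>i. \<bar>x i - y i\<bar> \<le> \<epsilon>)"

lemma nearby_sym: "nearby \<epsilon> x y \<Longrightarrow> nearby \<epsilon> y x"
  by (simp add: nearby_def abs_minus_commute)

lemma nearby_triangle: "nearby a x y \<Longrightarrow> nearby b y z \<Longrightarrow> nearby (a + b) x z"
  unfolding nearby_def
proof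
  fix i assume "\<forall>i. \<bar>x i - y i\<bar> \<le> a" "\<forall>i. \<bar>y i - z i\<bar> \<le> b"
  then have "\<bar>x i - y i\<bar> \<le> a" "\<bar>y i - z i\<bar> \<le> b" by auto
  then show "\<bar>x i - z i\<bar> \<le> a + b" by linarith
qed

lemma nearby_mono: "nearby a x y \<Longrightarrow> a \<le> b \<Longrightarrow> nearby b x y"
  unfolding nearby_def by (meson order_trans)

definition small_chain ::
  "(nat \<Rightarrow> real) set \<Rightarrow> nat \<Rightarrow> real \<Rightarrow> (nat \<Rightarrow> real) list list \<Rightarrow> bool" where
  "small_chain X m \<epsilon> C \<longleftrightarrow>
     (\<forall>s\<in>set C. length s = m \<and> set s \<subseteq> X \<and> (\<forall>x\<in>set s. \<forall>y\<in>set s. nearby \<epsilon> x y))"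

lemma small_chain_mono:
  "small_chain X m \<delta> C \<Longrightarrow> X \<subseteq> Y \<Longrightarrow> \<delta> \<le> \<epsilon> \<Longrightarrow> small_chain Y m \<epsilon> C"
  unfolding small_chain_def by (meson nearby_mono order_trans)

lemma small_chain_append [simp]:
  "small_chain X m \<epsilon> (C @ D) \<longleftrightarrow> small_chain X m \<epsilon> C \<and> small_chain X m \<epsilon> D"
  by (auto simp: small_chain_def)

lemma small_chain_prisms:
  assumes C: "\<And>s. s \<in> set C \<Longrightarrow> length s = m"
    and X: "\<And>s x. s \<in> set C \<Longrightarrow> x \<in> set s \<Longrightarrow> g x \<in> X \<and> h x \<in> X"
    and near: "\<And>s x y. s \<in> set C \<Longrightarrow> x \<in> set s \<Longrightarrow> y \<in> set s \<Longrightarrow>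
      nearby \<epsilon> (g x) (g y) \<and> nearby \<epsilon> (g x) (h y) \<and> nearby \<epsilon> (h x) (h y)"
  shows "small_chain X (Suc m) \<epsilon> (prisms g h C)"
  unfolding small_chain_def prisms_def
proof safe
  fix t assume "t \<in> set (concat (map (prism g h) C))"
  then obtain s where s: "s \<in> set C" and t: "t \<in> set (prism g h s)" by auto
  note * = prism_elem[OF t]
  show "length t = Suc m" using * C[OF s] by simp
  show "x \<in> X" if "x \<in> set t" for x
    using that * X[OF s] by blast
  show "nearby \<epsilon> x y" if "x \<in> set t" "y \<in> set t" for x y
    using that * near[OF s] nearby_sym by blast
qed

text \<open>
  Contract the cycle to \<open>p\<close> in so many steps that no point moves by more than \<open>\<delta>\<close> in one step. The
  prisms of consecutive steps have diameter at most \<open>2 * \<delta>\<close>; after the last step the cycle sits at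
  \<open>p\<close>, where a cone bounds it.
\<close>

lemma star_shaped_filling:
  assumes star: "\<And>x t. x \<in> X \<Longrightarrow> 0 \<le> t \<Longrightarrow> t \<le> 1 \<Longrightarrow> (\<lambda>i. x i + t * (p i - x i)) \<in> X"
    and p: "p \<in> X" and bounded: "\<And>x. x \<in> X \<Longrightarrow> nearby B x p"
    and "\<delta> > 0" and C: "small_chain X m \<delta> C" and cyc: "boundary C \<simeq> []"
  obtains E where "small_chain X (Suc m) (2 * \<delta>) E" "boundary E \<simeq> C"
proof -
  have B: "B \<ge> 0" using bounded[OF p] by (simp add: nearby_def)
  obtain N :: nat where N: "B < real N * \<delta>"
    using reals_Archimedean3[OF \<open>\<delta> > 0\<close>] by blast
  with B \<open>\<delta> > 0\<close> have "N > 0" by (cases N) auto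
  define h where "h j x i = x i + (real j / real N) * (p i - x i)" for j and x :: "nat \<Rightarrow> real" and i
  have hX: "h j x \<in> X" if "x \<in> X" "j \<le> N" for j x
    using star[OF that(1), of "real j / real N"] that(2) \<open>N > 0\<close> by (simp add: h_def[abs_def])
  have contract: "nearby \<delta> (h j x) (h j y)" if "nearby \<delta> x y" "j \<le> N" for j x y
    unfolding nearby_def
  proof
    fix i
    have "h j x i - h j y i = (1 - real j / real N) * (x i - y i)"
      using \<open>N > 0\<close> by (simp add: h_def field_simps)
    moreover have "0 \<le> 1 - real j / real N" "1 - real j / real N \<le> 1" using that \<open>N > 0\<close> by auto
    ultimately have "\<bar>h j x i - h j y i\<bar> \<le> \<bar>x i - y i\<bar>"
      by (simp add: abs_mult mult_left_le_one_le)
    then show "\<bar>h j x i - h j y i\<bar> \<le> \<delta>" using that(1) by (auto simp: nearby_def intro: order_trans)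
  qed
  have move: "nearby \<delta> (h j x) (h (Suc j) x)" if "x \<in> X" for j x
    unfolding nearby_def
  proof
    fix i
    have "h (Suc j) x i - h j x i = (p i - x i) / real N"
      by (simp add: h_def add_divide_distrib diff_divide_distrib ring_distribs)
    moreover have "\<bar>p i - x i\<bar> \<le> B" 
      using bounded[OF that] by (simp add: nearby_def abs_minus_commute)
    then have "\<bar>p i - x i\<bar> / real N \<le> \<delta>"
      using N \<open>N > 0\<close> by (simp add: field_simps)
    moreover have "\<bar>h j x i - h (Suc j) x i\<bar> = \<bar>h (Suc j) x i - h j x i\<bar>" by simp
    ultimately show "\<bar>h j x i - h (Suc j) x i\<bar> \<le> \<delta>" by simp
  qed
  have "\<exists>E. small_chain X (Suc m) (2 * \<delta>) E \<and>
          (\<forall>f. pairing f (boundary E) = pairing f C + pairing f (map (map (h j)) C))" if "j \<le> N" for j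
    using that
  proof (induction j)
    case 0
    have "h 0 = (\<lambda>x. x)" by (simp add: fun_eq_iff h_def)
    then show ?case by (intro exI[of _ "[]"]) (auto simp: small_chain_def boundary_def)
  next
    case (Suc j)
    then obtain E where E: "small_chain X (Suc m) (2 * \<delta>) E"
      "\<And>f. pairing f (boundary E) = pairing f C + pairing f (map (map (h j)) C)" by auto
    have "small_chain X (Suc m) (2 * \<delta>) (prisms (h j) (h (Suc j)) C)"
    proof (rule small_chain_prisms)
      fix s x y assume s: "s \<in> set C" and x: "x \<in> set s" and y: "y \<in> set s"
      have xX: "x \<in> X" and yX: "y \<in> X" and xy: "nearby \<delta> x y"
        using C s x y by (auto simp: small_chain_def)
      have "nearby (\<delta> + \<delta>) (h j x) (h (Suc j) y)"
        using contract[OF xy, of j] move[OF yX, of j] Suc.prems by (intro nearby_triangle) auto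
      then show "nearby (2 * \<delta>) (h j x) (h j y) \<and> nearby (2 * \<delta>) (h j x) (h (Suc j) y)
          \<and> nearby (2 * \<delta>) (h (Suc j) x) (h (Suc j) y)"
        using contract[OF xy, of j] contract[OF xy, of "Suc j"] Suc.prems \<open>\<delta> > 0\<close>
        by (auto elim: nearby_mono)
    next
      show "length s = m" if "s \<in> set C" for s using C that by (simp add: small_chain_def)
      show "h j x \<in> X \<and> h (Suc j) x \<in> X" if "s \<in> set C" "x \<in> set s" for s x
        using C that Suc.prems by (auto simp: small_chain_def subset_iff intro!: hX)
    qed
    then show ?case
      using E by (intro exI[of _ "E @ prisms (h j) (h (Suc j)) C"])
        (simp add: boundary_append boundary_prisms[OF cyc] add.assoc)
  qed
  from this[of N] obtain E where E: "small_chain X (Suc m) (2 * \<delta>) E"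
    "\<And>f. pairing f (boundary E) = pairing f C + pairing f (map (map (h N)) C)" by auto
  define F where "F = map ((#) p) (map (map (h N)) C)"
  have hN: "h N x = p" for x using \<open>N > 0\<close> by (auto simp: h_def)
  have "small_chain X (Suc m) (2 * \<delta>) F"
    unfolding small_chain_def
  proof
    fix t assume "t \<in> set F"
    then obtain s where s: "s \<in> set C" and t: "t = p # map (h N) s" by (auto simp: F_def)
    have "set t = {p}" using hN by (auto simp: t)
    then show "length t = Suc m \<and> set t \<subseteq> X \<and> (\<forall>x\<in>set t. \<forall>y\<in>set t. nearby (2 * \<delta>) x y)"
      using s C p \<open>\<delta> > 0\<close> by (auto simp: t hN small_chain_def nearby_def)
  qed
  moreover have "pairing f (boundary F) = pairing f (map (map (h N)) C)" for f
    using cyc unfolding F_def boundary_cone boundary_map pairing_map[of _ "map (h N)"] equal_mod2_def by simp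
  then have "boundary (E @ F) \<simeq> C"
    by (simp add: equal_mod2_def boundary_append E(2) add.assoc)
  ultimately show thesis using E(1) that[of "E @ F"] by simp
qed


text \<open>
  The boundary of the cross-polytope is used in place of the round sphere because its closed
  hemispheres are star-shaped: segments to the pole stay inside. All deformations are then affine
  and come with explicit bounds.
\<close>

definition l1_sphere :: "nat \<Rightarrow> (nat \<Rightarrow> real) set" where
  "l1_sphere n = {x. (\<Sum>i\<le>n. \<bar>x i\<bar>) = 1 \<and> (\<forall>i>n. x i = 0)}"

lemma l1_sphere_abs_le_1: "x \<in> l1_sphere n \<Longrightarrow> \<bar>x i\<bar> \<le> 1"
  using member_le_sum[of i "{..n}" "\<lambda>i. \<bar>x i\<bar>"]
  by (cases "i \<le> n") (auto simp: l1_sphere_def)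

lemma l1_sphere_unit_vector: "k \<le> n \<Longrightarrow> \<bar>a\<bar> = 1 \<Longrightarrow> (\<lambda>i. if i = k then a else 0) \<in> l1_sphere n"
  by (simp add: l1_sphere_def if_distrib[of abs] cong: if_cong)

lemma l1_sphere_Suc_mono: "l1_sphere n \<subseteq> l1_sphere (Suc n)"
  by (auto simp: l1_sphere_def)

text \<open>
  The sign \<open>\<sigma>\<close> selects the upper or the lower hemisphere, which is contracted along segments to
  its pole.
\<close>

lemma hemisphere_filling:
  fixes \<sigma> :: real and n :: nat
  defines "H \<equiv> {x \<in> l1_sphere (Suc n). \<sigma> * x (Suc n) \<ge> 0}"
  assumes \<sigma>: "\<bar>\<sigma>\<bar> = 1"
    and "\<delta> > 0" "small_chain H m \<delta> C" "boundary C \<simeq> []"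
  obtains E where "small_chain H (Suc m) (2 * \<delta>) E" "boundary E \<simeq> C"
proof (rule star_shaped_filling[where X = H and p = "\<lambda>i. if i = Suc n then \<sigma> else 0" and B = 2])
  let ?p = "\<lambda>i. if i = Suc n then \<sigma> else 0"
  have \<sigma>2: "\<sigma> * \<sigma> = 1" using \<sigma> by (metis abs_mult_self_eq mult_1)
  show p: "?p \<in> H"
    using l1_sphere_unit_vector[of "Suc n" "Suc n" \<sigma>] \<sigma> \<sigma>2 by (simp add: H_def)
  show "nearby 2 x ?p" if "x \<in> H" for x
    unfolding nearby_def
  proof
    fix i
    have "\<bar>x i\<bar> \<le> 1" "\<bar>?p i\<bar> \<le> 1"
      using l1_sphere_abs_le_1[of x "Suc n" i] that \<sigma> by (auto simp: H_def)
    then show "\<bar>x i - ?p i\<bar> \<le> 2" by linarith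
  qed
  show "(\<lambda>i. x i + t * (?p i - x i)) \<in> H" if x: "x \<in> H" and t: "0 \<le> t" "t \<le> 1" for x t
  proof -
    let ?y = "\<lambda>i. x i + t * (?p i - x i)"
    have \<sigma>x: "0 \<le> \<sigma> * x (Suc n)" using x by (simp add: H_def)
    have abs_\<sigma>: "\<bar>c\<bar> = \<sigma> * c" if "0 \<le> \<sigma> * c" for c
      using that \<sigma> by (metis abs_mult abs_of_nonneg mult_1)
    have eq: "\<sigma> * ?y (Suc n) = (1 - t) * (\<sigma> * x (Suc n)) + t"
      using \<sigma>2 by (simp add: algebra_simps)
    have nonneg: "0 \<le> \<sigma> * ?y (Suc n)"
      unfolding eq using \<sigma>x t by simp
    have "(\<Sum>i\<le>n. \<bar>?y i\<bar>) = (\<Sum>i\<le>n. (1 - t) * \<bar>x i\<bar>)"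
    proof (rule sum.cong)
      fix i assume "i \<in> {..n}"
      then have "?y i = (1 - t) * x i" by (simp add: algebra_simps)
      then show "\<bar>?y i\<bar> = (1 - t) * \<bar>x i\<bar>" using t by (simp add: abs_mult)
    qed simp
    also have "\<dots> = (1 - t) * (1 - \<bar>x (Suc n)\<bar>)"
      using x by (simp add: H_def l1_sphere_def sum_distrib_left[symmetric])
    also have "\<dots> = 1 - \<bar>?y (Suc n)\<bar>"
      unfolding abs_\<sigma>[OF nonneg] eq abs_\<sigma>[OF \<sigma>x] by (simp add: algebra_simps)
    finally have "(\<Sum>i\<le>Suc n. \<bar>?y i\<bar>) = 1"
      unfolding sum.atMost_Suc by linarith
    then show ?thesis using x nonneg by (auto simp: H_def l1_sphere_def)
  qed
qed (use assms in auto)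

text \<open>
  Points close to the equator are moved onto it by shifting the weight of the coordinate \<open>k\<close> to
  the coordinate 0, all others stay. The map is not continuous, but it is close to the identity,
  and this is all that chains of small tuples can see.
\<close>

definition to_equator :: "nat \<Rightarrow> real \<Rightarrow> (nat \<Rightarrow> real) \<Rightarrow> nat \<Rightarrow> real" where
  "to_equator k \<delta> x =
     (if \<bar>x k\<bar> \<le> \<delta> then x(0 := x 0 + (if x 0 \<ge> 0 then \<bar>x k\<bar> else - \<bar>x k\<bar>), k := 0) else x)"

lemma to_equator_nearby: "\<delta> \<ge> 0 \<Longrightarrow> nearby \<delta> x (to_equator k \<delta> x)"
  by (auto simp: nearby_def to_equator_def)

lemma to_equator_in_equator:
  assumes x: "x \<in> l1_sphere (Suc n)" and small: "\<bar>x (Suc n)\<bar> \<le> \<delta>"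
  shows "to_equator (Suc n) \<delta> x \<in> l1_sphere n"
proof -
  let ?y = "to_equator (Suc n) \<delta> x"
  have "(\<Sum>i\<le>n. \<bar>?y i\<bar>) = \<bar>?y 0\<bar> + (\<Sum>i\<in>{..n} - {0}. \<bar>?y i\<bar>)"
    by (rule sum.remove) auto
  also have "(\<Sum>i\<in>{..n} - {0}. \<bar>?y i\<bar>) = (\<Sum>i\<in>{..n} - {0}. \<bar>x i\<bar>)"
    by (rule sum.cong) (auto simp: to_equator_def)
  also have "\<bar>?y 0\<bar> = \<bar>x 0\<bar> + \<bar>x (Suc n)\<bar>"
    using small by (auto simp: to_equator_def)
  also have "\<bar>x 0\<bar> + \<bar>x (Suc n)\<bar> + (\<Sum>i\<in>{..n} - {0}. \<bar>x i\<bar>) = (\<Sum>i\<le>n. \<bar>x i\<bar>) + \<bar>x (Suc n)\<bar>"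
    using sum.remove[of "{..n}" 0 "\<lambda>i. \<bar>x i\<bar>"] by simp
  also have "\<dots> = 1" using x by (simp add: l1_sphere_def)
  finally show ?thesis using x small by (auto simp: l1_sphere_def to_equator_def)
qed

lemma to_equator_hemisphere:
  assumes x: "x \<in> l1_sphere (Suc n)" and "- \<delta> \<le> \<sigma> * x (Suc n)" "\<bar>\<sigma>\<bar> = 1"
  shows "to_equator (Suc n) \<delta> x \<in> {x \<in> l1_sphere (Suc n). \<sigma> * x (Suc n) \<ge> 0}"
proof (cases "\<bar>x (Suc n)\<bar> \<le> \<delta>")
  case True
  then show ?thesis
    using to_equator_in_equator[OF x True] l1_sphere_Suc_mono[of n] by (auto simp: l1_sphere_def)
next
  case False
  then have "\<delta> < \<bar>\<sigma> * x (Suc n)\<bar>" using assms(3) by (simp add: abs_mult)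
  then have "0 \<le> \<sigma> * x (Suc n)" using assms(2) by linarith
  then show ?thesis using x False by (simp add: to_equator_def)
qed

text \<open>
  Reduced homology of an \<open>n\<close>-sphere vanishes below \<open>n\<close>, with a bound on the size of the filling. A
  tuple of length \<open>m\<close> is a simplex of dimension \<open>m - 1\<close>, whence \<open>m \<le> n\<close>. This is the
  Mayer-Vietoris argument: cut the cycle \<open>C\<close> into an upper part \<open>Cp\<close> and a lower part \<open>Cm\<close>; their
  common boundary \<open>W\<close> lies near the equator, is pushed onto it, and bounds there some \<open>V\<close> by
  induction. Each part together with \<open>V\<close> is a cycle in a hemisphere.
\<close>

theorem sphere_filling:
  assumes "m \<le> n"
  shows "\<exists>K\<ge>1. \<forall>\<delta>>0. \<forall>C. small_chain (l1_sphere n) m \<delta> C \<longrightarrow> boundary C \<simeq> [] \<longrightarrow>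
           (\<exists>E. small_chain (l1_sphere n) (Suc m) (K * \<delta>) E \<and> boundary E \<simeq> C)"
  using assms
proof (induction n arbitrary: m)
  have point: "\<exists>E. small_chain (l1_sphere n) (Suc 0) (1 * \<delta>) E \<and> boundary E \<simeq> C"
    if C: "small_chain (l1_sphere n) 0 \<delta> C" and "\<delta> > 0" for n \<delta> C
  proof -
    let ?p = "\<lambda>i. if i = 0 then 1 else (0::real)"
    have nil: "s = []" if "s \<in> set C" for s using C that by (auto simp: small_chain_def)
    have "pairing f (boundary (map ((#) ?p) C)) = pairing f C" for f
      unfolding pairing_boundary pairing_map by (rule pairing_cong) (auto dest: nil)
    moreover have "small_chain (l1_sphere n) (Suc 0) (1 * \<delta>) (map ((#) ?p) C)"
      unfolding small_chain_def
    proof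
      fix t assume "t \<in> set (map ((#) ?p) C)"
      then have "t = [?p]" using nil by auto
      then show "length t = Suc 0 \<and> set t \<subseteq> l1_sphere n \<and> (\<forall>x\<in>set t. \<forall>y\<in>set t. nearby (1 * \<delta>) x y)"
        using l1_sphere_unit_vector[of 0 n 1] \<open>\<delta> > 0\<close> by (simp add: nearby_def)
    qed
    ultimately show ?thesis unfolding equal_mod2_def by blast
  qed
  {
    case 0
    then show ?case using point[of 0] by (intro exI[of _ 1]) auto
  next
    case (Suc n)
    show ?case
    proof (cases m)
      case 0
      then show ?thesis using point[of "Suc n"] by (intro exI[of _ 1]) auto
    next
      case (Suc m')
      with Suc.prems have "m' \<le> n" by simp
      from Suc.IH[OF this] obtain K where K: "K \<ge> 1"
        and IH: "\<And>\<delta> C. \<delta> > 0 \<Longrightarrow> small_chain (l1_sphere n) m' \<delta> C \<Longrightarrow> boundary C \<simeq> [] \<Longrightarrow>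
          \<exists>E. small_chain (l1_sphere n) (Suc m') (K * \<delta>) E \<and> boundary E \<simeq> C" by blast
      have "\<exists>E. small_chain (l1_sphere (Suc n)) (Suc m) (10 * K * \<delta>) E \<and> boundary E \<simeq> C"
        if "\<delta> > 0" and C: "small_chain (l1_sphere (Suc n)) m \<delta> C" and cyc: "boundary C \<simeq> []" for \<delta> C
      proof -
        let ?h = "to_equator (Suc n) \<delta>"
        let ?H = "\<lambda>\<sigma>. {x \<in> l1_sphere (Suc n). \<sigma> * x (Suc n) \<ge> (0::real)}"
        define Cp where "Cp = filter (\<lambda>s. hd s (Suc n) \<ge> 0) C"
        define Cm where "Cm = filter (\<lambda>s. \<not> hd s (Suc n) \<ge> 0) C"
        \<comment> \<open>The two boundaries agree modulo 2 but may differ as lists. Only tuples in both can survive, and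
        these have all their points near the equator.\<close>
        define W where "W = filter (\<lambda>t. t \<in> set (boundary Cm)) (boundary Cp)"
        have split: "pairing f C = pairing f Cp + pairing f Cm" for f
          unfolding Cp_def Cm_def by (rule pairing_partition)
        have same_boundary: "pairing f (boundary Cp) = pairing f (boundary Cm)" for f
          using cyc split[of "coboundary f"]
              by (auto simp: equal_mod2_def pairing_boundary intro: bit_eqI)
        have W: "pairing f W = pairing f (boundary Cp)" for f
        proof -
          have "pairing f W = pairing (\<lambda>t. if t \<in> set (boundary Cm) then f t else 0) (boundary Cm)"
            unfolding W_def pairing_filter by (rule same_boundary)
          also have "\<dots> = pairing f (boundary Cm)" by (rule pairing_cong) simp
          finally show ?thesis by (simp add: same_boundary)
        qed
        have elem: "length s = m" "x \<in> l1_sphere (Suc n)" "nearby \<delta> x y"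
          if "s \<in> set C" "x \<in> set s" "y \<in> set s" for s x y
          using C that by (auto simp: small_chain_def)
        have hd_in: "hd s \<in> set s" if "s \<in> set C" for s
          using C that Suc by (cases s) (auto simp: small_chain_def)
        have near_hd: "\<bar>x (Suc n) - hd s (Suc n)\<bar> \<le> \<delta>" if "s \<in> set C" "x \<in> set s" for s x
          using elem(3)[OF that(1,2) hd_in[OF that(1)]] by (simp add: nearby_def)
        have Cp: "s \<in> set C" "- \<delta> \<le> 1 * x (Suc n)" if "s \<in> set Cp" "x \<in> set s" for s x
          using that near_hd[of s x] by (auto simp: Cp_def)
        have Cm: "s \<in> set C" "- \<delta> \<le> -1 * x (Suc n)" if "s \<in> set Cm" "x \<in> set s" for s x
          using that near_hd[of s x] by (auto simp: Cm_def)
        have h_near: "nearby (5 * \<delta>) (?h x) (?h y)" "nearby (5 * \<delta>) x (?h y)" "nearby (5 * \<delta>) x y"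
          if "nearby \<delta> x y" for x y
        proof -
          have *: "nearby \<delta> z (?h z)" for z using \<open>\<delta> > 0\<close> by (simp add: to_equator_nearby)
          have 2: "nearby (\<delta> + \<delta>) x (?h y)" using nearby_triangle[OF that *] .
          have "nearby (\<delta> + (\<delta> + \<delta>)) (?h x) (?h y)" using nearby_triangle[OF nearby_sym[OF *] 2] .
          with 2 that show "nearby (5 * \<delta>) (?h x) (?h y)" "nearby (5 * \<delta>) x (?h y)" "nearby (5 * \<delta>) x y"
            using \<open>\<delta> > 0\<close> by (auto elim: nearby_mono)
        qed
        have hW: "small_chain (l1_sphere n) m' (5 * \<delta>) (map (map ?h) W)"
          unfolding small_chain_def
        proof
          fix t' assume "t' \<in> set (map (map ?h) W)"
          then obtain t where t: "t \<in> set (boundary Cp)" "t \<in> set (boundary Cm)" "t' = map ?h t"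
            by (auto simp: W_def)
          then obtain s r where s: "s \<in> set Cp" "t \<in> set (faces s)" and r: "r \<in> set Cm" "t \<in> set (faces r)"
            by (auto simp: boundary_def)
          have sub: "set t \<subseteq> set s" "set t \<subseteq> set r" "length s = Suc (length t)"
            using faces_subset[OF s(2)] faces_subset[OF r(2)] by auto
          have sC: "s \<in> set C" using s(1) by (simp add: Cp_def)
          have "length t = m'" using sub(3) sC C Suc by (auto simp: small_chain_def)
          moreover have "?h x \<in> l1_sphere n" if "x \<in> set t" for x
          proof (rule to_equator_in_equator)
            show "x \<in> l1_sphere (Suc n)" using elem(2)[OF sC] that sub(1) by blast
            show "\<bar>x (Suc n)\<bar> \<le> \<delta>"
              using Cp(2)[OF s(1), of x] Cm(2)[OF r(1), of x] that sub
              by (auto simp: abs_le_iff)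
          qed
          moreover have "nearby (5 * \<delta>) (?h x) (?h y)" if "x \<in> set t" "y \<in> set t" for x y
            using h_near(1) elem(3)[OF sC] that sub(1) by blast
          ultimately show "length t' = m' \<and> set t' \<subseteq> l1_sphere n \<and>
              (\<forall>x\<in>set t'. \<forall>y\<in>set t'. nearby (5 * \<delta>) x y)"
            by (auto simp: t(3))
        qed
        have "pairing f (boundary (map (map ?h) W)) = 0" for f
          unfolding boundary_map pairing_map unfolding pairing_boundary unfolding W
              unfolding pairing_boundary by simp
        then have "boundary (map (map ?h) W) \<simeq> []" by (simp add: equal_mod2_def)
        from IH[OF _ hW this] \<open>\<delta> > 0\<close> obtain V
          where V: "small_chain (l1_sphere n) m (K * (5 * \<delta>)) V"
            and boundary_V: "\<And>f. pairing f (boundary V) = pairing f (map (map ?h) W)"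
          by (auto simp: equal_mod2_def Suc)
        have "5 * \<delta> \<le> K * (5 * \<delta>)" using K \<open>\<delta> > 0\<close> by simp
        \<comment> \<open>Closing one of the two parts with V; the sign and the part vary.\<close>
        have cap: "\<exists>E. small_chain (l1_sphere (Suc n)) (Suc m) (10 * K * \<delta>) E \<and>
            boundary E \<simeq> map (map ?h) D @ V"
          if \<sigma>: "\<bar>\<sigma>\<bar> = 1" and DC: "set D \<subseteq> set C"
            and D: "\<And>s x. s \<in> set D \<Longrightarrow> x \<in> set s \<Longrightarrow> - \<delta> \<le> \<sigma> * x (Suc n)"
            and boundary_D: "\<And>f. pairing f (boundary D) = pairing f W" for \<sigma> :: real and D
        proof -
          have "small_chain (?H \<sigma>) m (5 * \<delta>) (map (map ?h) D)"
            unfolding small_chain_def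
          proof
            fix t assume "t \<in> set (map (map ?h) D)"
            then obtain s where s: "s \<in> set D" "t = map ?h s" by auto
            have sC: "s \<in> set C" using s DC by auto
            have "?h x \<in> ?H \<sigma>" if "x \<in> set s" for x
              using to_equator_hemisphere[OF elem(2)[OF sC that that] D[OF s(1) that] \<sigma>] .
            moreover have "length s = m" using sC C by (simp add: small_chain_def)
            ultimately show "length t = m \<and> set t \<subseteq> ?H \<sigma> \<and> (\<forall>x\<in>set t. \<forall>y\<in>set t. nearby (5 * \<delta>) x y)"
              using h_near(1) elem(3)[OF sC] by (auto simp: s(2))
          qed
          then have "small_chain (?H \<sigma>) m (K * (5 * \<delta>)) (map (map ?h) D)"
            using \<open>5 * \<delta> \<le> K * (5 * \<delta>)\<close> by (rule small_chain_mono[OF _ subset_refl])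
          moreover have "l1_sphere n \<subseteq> ?H \<sigma>"
            using l1_sphere_Suc_mono[of n] by (auto simp: l1_sphere_def)
          with V have "small_chain (?H \<sigma>) m (K * (5 * \<delta>)) V"
            by (rule small_chain_mono) simp
          ultimately have small: "small_chain (?H \<sigma>) m (K * (5 * \<delta>)) (map (map ?h) D @ V)" by simp
          have "pairing f (boundary (map (map ?h) D @ V)) = 0" for f
            unfolding boundary_append boundary_map pairing_simps(3) boundary_V pairing_map boundary_D by simp
          then have cyc: "boundary (map (map ?h) D @ V) \<simeq> []" by (simp add: equal_mod2_def)
          have "0 < K * (5 * \<delta>)" using K \<open>\<delta> > 0\<close> by simp
          then obtain E where "small_chain (?H \<sigma>) (Suc m) (2 * (K * (5 * \<delta>))) E"
            "boundary E \<simeq> map (map ?h) D @ V"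
            using hemisphere_filling[OF \<sigma> _ small cyc] by blast
          then show ?thesis
            by (intro exI[of _ E]) (auto elim!: small_chain_mono)
        qed
        obtain Ep where Ep: "small_chain (l1_sphere (Suc n)) (Suc m) (10 * K * \<delta>) Ep"
            "boundary Ep \<simeq> map (map ?h) Cp @ V"
        proof -
          have "set Cp \<subseteq> set C" by (auto simp: Cp_def)
          have "\<exists>E. small_chain (l1_sphere (Suc n)) (Suc m) (10 * K * \<delta>) E \<and> boundary E
              \<simeq> map (map ?h) Cp @ V"
            by (rule cap[of 1 Cp]) (simp, fact, erule Cp(2), assumption, rule W[symmetric])
          then show thesis using that by blast
        qed
        obtain Em where Em: "small_chain (l1_sphere (Suc n)) (Suc m) (10 * K * \<delta>) Em"
            "boundary Em \<simeq> map (map ?h) Cm @ V"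
        proof -
          have "set Cm \<subseteq> set C" by (auto simp: Cm_def)
          have "\<exists>E. small_chain (l1_sphere (Suc n)) (Suc m) (10 * K * \<delta>) E \<and> boundary E
              \<simeq> map (map ?h) Cm @ V"
            by (rule cap[of "-1" Cm]) (simp, fact, erule Cm(2), assumption, simp add: W same_boundary)
          then show thesis using that by blast
        qed
        define P where "P = prisms (\<lambda>x. x) ?h C"
        have "small_chain (l1_sphere (Suc n)) (Suc m) (5 * \<delta>) P"
          unfolding P_def
        proof (rule small_chain_prisms)
          show "length s = m" if "s \<in> set C" for s using C that by (simp add: small_chain_def)
          show "x \<in> l1_sphere (Suc n) \<and> ?h x \<in> l1_sphere (Suc n)" if "s \<in> set C" "x \<in> set s" for s x
            using elem(2)[OF that(1,2,2)] to_equator_in_equator[of x n \<delta>] l1_sphere_Suc_mono[of n]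
            by (cases "\<bar>x (Suc n)\<bar> \<le> \<delta>") (auto simp: to_equator_def)
          show "nearby (5 * \<delta>) x y \<and> nearby (5 * \<delta>) x (?h y) \<and> nearby (5 * \<delta>) (?h x) (?h y)"
            if "s \<in> set C" "x \<in> set s" "y \<in> set s" for s x y
            using h_near[OF elem(3)[OF that]] by blast
        qed
        then have "small_chain (l1_sphere (Suc n)) (Suc m) (10 * K * \<delta>) P"
          by (rule small_chain_mono) (use K \<open>\<delta> > 0\<close> in auto)
        moreover have "pairing f (boundary (Ep @ Em @ P)) = pairing f C" for f
        proof -
          have "pairing f (boundary P) = pairing f C + pairing f (map (map ?h) C)"
            unfolding P_def boundary_prisms[OF cyc] by simp
          moreover have "pairing f (map (map ?h) C) = pairing f (map (map ?h) Cp)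
              + pairing f (map (map ?h) Cm)"
            unfolding pairing_map by (rule split)
          moreover have "pairing f (boundary Ep) = pairing f (map (map ?h) Cp) + pairing f V"
            "pairing f (boundary Em) = pairing f (map (map ?h) Cm) + pairing f V"
            using Ep(2) Em(2) by (simp_all add: equal_mod2_def)
          ultimately show ?thesis
            unfolding boundary_append pairing_simps(3) by (simp only:) (simp add: algebra_simps)
        qed
        ultimately show ?thesis
          using Ep Em unfolding equal_mod2_def by (intro exI[of _ "Ep @ Em @ P"]) simp
      qed
      moreover have "1 \<le> 10 * K" using K by simp
      ultimately show ?thesis by (intro exI[of _ "10 * K"]) blast
    qed
  }
qed

section \<open>The index cochains of a labelling\<close>

lemma antipode_antipode [simp]: "antipode (antipode x) = x"
  by (simp add: antipode_def)

lemma antipode_in_l1_sphere: "x \<in> l1_sphere n \<Longrightarrow> antipode x \<in> l1_sphere n"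
  by (simp add: l1_sphere_def antipode_def)

lemma nearby_antipode: "nearby \<epsilon> x y \<Longrightarrow> nearby \<epsilon> (antipode x) (antipode y)"
  by (simp add: nearby_def antipode_def abs_minus_commute)

text \<open>
  The antipodal involution on tuples. Reversing the order makes it exchange the front and the back
  part of a tuple, and so compatible with the cup product: if the front of \<open>s\<close> is labelled by \<open>f\<close>
  and its back by \<open>f \<circ> antipode\<close>, the roles are exchanged for \<open>reverse_antipode s\<close>.
\<close>

definition reverse_antipode :: "(nat \<Rightarrow> real) list \<Rightarrow> (nat \<Rightarrow> real) list" where
  "reverse_antipode s = map antipode (rev s)"

lemma reverse_antipode_reverse_antipode [simp]: "reverse_antipode (reverse_antipode s) = s"
  by (simp add: reverse_antipode_def rev_map o_def)

lemma coboundary_reverse_antipode: "coboundary f (reverse_antipode s)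
    = coboundary (\<lambda>t. f (reverse_antipode t)) s"
  by (simp add: reverse_antipode_def deletion_sum_map deletion_sum_rev)

lemma small_chain_reverse_antipode:
  assumes "small_chain (l1_sphere n) m \<epsilon> C"
  shows "small_chain (l1_sphere n) m \<epsilon> (map reverse_antipode C)"
  unfolding small_chain_def
proof
  fix t assume "t \<in> set (map reverse_antipode C)"
  then obtain s where s: "s \<in> set C" "t = reverse_antipode s" by auto
  have "length s = m" "set s \<subseteq> l1_sphere n" "\<And>x y. x \<in> set s \<Longrightarrow> y \<in> set s \<Longrightarrow> nearby \<epsilon> x y"
    using assms s(1) by (auto simp: small_chain_def)
  then show "length t = m \<and> set t \<subseteq> l1_sphere n \<and> (\<forall>x\<in>set t. \<forall>y\<in>set t. nearby \<epsilon> x y)"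
    by (auto simp: s(2) reverse_antipode_def antipode_in_l1_sphere nearby_antipode subset_iff)
qed

lemma pairing_sum: "pairing (\<lambda>s. \<Sum>a\<in>A. g a s) C = (\<Sum>a\<in>A. pairing (g a) C)"
  by (induction C) (simp_all add: sum.distrib)

text \<open>
  The labels are sets of points, which carry no canonical order; a well-ordering of the type
  supplies one.
\<close>

lemma tournament_exists: "\<exists>R :: 'l \<Rightarrow> 'l \<Rightarrow> bool. \<forall>x y. x \<noteq> y \<longrightarrow> R x y \<noteq> R y x"
proof -
  obtain r :: "'l rel" where r: "Well_order r" "Field r = UNIV"
    using well_ordering[where 'a = 'l] by (elim exE conjE) (rule that)
  then have tot: "total_on UNIV r" and anti: "antisym r"
    by (simp_all add: well_order_on_def linear_order_on_def partial_order_on_def)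
  have "((x, y) \<in> r) \<noteq> ((y, x) \<in> r)" if "x \<noteq> y" for x y
    using that tot antisymD[OF anti, of x y] unfolding total_on_def by blast
  then show ?thesis by (intro exI[of _ "\<lambda>x y. (x, y) \<in> r"]) blast
qed

text \<open>
  The cochains \<open>\<Phi>\<^sub>2\<^sub>m\<close> and \<open>\<Phi>\<^sub>2\<^sub>m\<^sub>+\<^sub>1\<close>. For a linear order, \<open>\<Phi>\<^sub>2\<^sub>m\<close> is 1 if the labels \<open>a\<close> of the
  front half and the labels \<open>b\<close> of the antipodes of the back half alternate as \<open>a < b < \<dots> < a <
  b\<close>, and \<open>\<Phi>\<^sub>2\<^sub>m\<^sub>+\<^sub>1\<close> is 1 if they alternate as \<open>a < b < \<dots> < b < a\<close>: the coboundary in \<open>index_odd\<close>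
  adds a column of ones to the matrix, that is, a last \<open>b\<close> above everything. Front and back share
  one point, as in a cup product.
\<close>

definition index_even :: "('l \<Rightarrow> 'l \<Rightarrow> bool) \<Rightarrow> ((nat \<Rightarrow> real) \<Rightarrow> 'l) \<Rightarrow> nat \<Rightarrow> (nat \<Rightarrow> real) list \<Rightarrow> bit" where
  "index_even R lab m s =
     permanent R (map lab (take (Suc m) s)) (map (\<lambda>x. lab (antipode x)) (drop m s))"

definition index_odd :: "('l \<Rightarrow> 'l \<Rightarrow> bool) \<Rightarrow> ((nat \<Rightarrow> real) \<Rightarrow> 'l) \<Rightarrow> nat \<Rightarrow> (nat \<Rightarrow> real) list \<Rightarrow> bit" where
  "index_odd R lab m s =
     coboundary (\<lambda>a. permanent R a (map
         (\<lambda>x. lab (antipode x)) (drop (Suc m) s))) (map lab (take (Suc (Suc m)) s))"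

lemma map_lab_reverse_antipode:
  "map lab (take j (reverse_antipode s)) = rev (map (\<lambda>x. lab (antipode x)) (drop (length s - j) s))"
  "map (\<lambda>x. lab (antipode x)) (drop j (reverse_antipode s)) = rev (map lab (take (length s - j) s))"
  by (simp_all add: reverse_antipode_def take_map drop_map take_rev drop_rev rev_map o_def)

lemma coboundary_permanent_perm:
  assumes "mset a = mset a'" "mset b = mset b'"
  shows "coboundary (\<lambda>c. permanent R c b) a = coboundary (\<lambda>c. permanent R c b') a'"
proof -
  have "coboundary (\<lambda>c. permanent R c b) a = coboundary (\<lambda>c. permanent R c b) a'"
    by (rule deletion_sum_perm[OF permanent_perm_left assms(1)])
  then show ?thesis using permanent_perm_right[OF assms(2)] by simp
qed

text \<open>
  The Leibniz rule gives two terms. The first is \<open>\<Phi>\<^sub>2\<^sub>m\<^sub>+\<^sub>1\<close> by definition, and transposing the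
  matrix in the second one gives \<open>\<Phi>\<^sub>2\<^sub>m\<^sub>+\<^sub>1\<close> of the reversed antipodal tuple.
\<close>

lemma coboundary_index_even:
  assumes len: "length s = Suc (Suc (2 * m))"
    and R: "\<And>x y. x \<in> set s \<Longrightarrow> y \<in> set s \<Longrightarrow> R (lab x) (lab (antipode y)) \<noteq> R (lab (antipode y)) (lab x)"
  shows "coboundary (index_even R lab m) s = index_odd R lab m s
      + index_odd R lab m (reverse_antipode s)"
proof -
  let ?a = "map lab (take (Suc m) s)" and ?b = "map (\<lambda>x. lab (antipode x)) (drop m s)"
  have "coboundary (index_even R lab m) s =
      coboundary (\<lambda>a. permanent R (map lab a) (map
          (\<lambda>x. lab (antipode x)) (drop (Suc m) s))) (take (Suc (Suc m)) s)
      + coboundary (\<lambda>b. permanent R ?a (map (\<lambda>x. lab (antipode x)) b)) (drop m s)"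
    unfolding index_even_def
    by (rule coboundary_kernel[where K
        = "\<lambda>a b. permanent R (map lab a) (map (\<lambda>x. lab (antipode x)) b)"])
      (simp add: len)
  also have "\<dots> = index_odd R lab m s + coboundary (permanent R ?a) ?b"
    by (simp add: index_odd_def deletion_sum_map)
  also have "coboundary (permanent R ?a) ?b = coboundary (\<lambda>c. permanent R c ?a) ?b"
    by (rule coboundary_permanent_transpose)
        (use R in \<open>auto simp: len dest!: in_set_takeD in_set_dropD\<close>)
  also have "\<dots> = index_odd R lab m (reverse_antipode s)"
    unfolding index_odd_def map_lab_reverse_antipode
        by (rule coboundary_permanent_perm) (simp_all add: len)
  finally show ?thesis .
qed

text \<open>
  Here the first term of the Leibniz rule is a double coboundary, so it vanishes, and the second
  one is the sum of all cofactors, \<open>M + M\<^sup>T\<close>.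
\<close>

lemma coboundary_index_odd:
  assumes len: "length s = Suc (Suc (Suc (2 * m)))"
    and R: "\<And>x y. x \<in> set s \<Longrightarrow> y \<in> set s \<Longrightarrow> R (lab x) (lab (antipode y)) \<noteq> R (lab (antipode y)) (lab x)"
  shows "coboundary (index_odd R lab m) s = index_even R lab (Suc m) s
      + index_even R lab (Suc m) (reverse_antipode s)"
proof -
  let ?a = "map lab (take (Suc (Suc m)) s)" and ?b = "map (\<lambda>x. lab (antipode x)) (drop (Suc m) s)"
  let ?K = "\<lambda>a b. coboundary (\<lambda>c. permanent R c (map (\<lambda>x. lab (antipode x)) b)) (map lab a)"
  have "coboundary (index_odd R lab m) s =
      coboundary (\<lambda>a. ?K a (drop (Suc (Suc m)) s)) (take (Suc (Suc (Suc m))) s)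
      + coboundary (\<lambda>b. ?K (take (Suc (Suc m)) s) b) (drop (Suc m) s)"
    unfolding index_odd_def by (rule coboundary_kernel[where K = ?K]) (simp add: len)
  also have "coboundary (\<lambda>a. ?K a (drop (Suc (Suc m)) s)) (take (Suc (Suc (Suc m))) s) = 0"
    unfolding deletion_sum_map[of "\<lambda>_. 1" _ lab] by (rule deletion_sum_square)
  also have "coboundary (\<lambda>b. ?K (take (Suc (Suc m)) s) b) (drop (Suc m) s)
      = coboundary (\<lambda>d. coboundary (\<lambda>c. permanent R c d) ?a) ?b"
    by (simp add: deletion_sum_map)
  also have "\<dots> = coboundary (\<lambda>c. coboundary (permanent R c) ?b) ?a"
    by (rule deletion_sum_swap)
  also have "\<dots> = permanent R ?a ?b + permanent R ?b ?a"
    by (rule coboundary_coboundary_permanent)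
        (use R in \<open>auto simp: len dest!: in_set_takeD in_set_dropD\<close>)
  also have "permanent R ?b ?a = index_even R lab (Suc m) (reverse_antipode s)"
  proof -
    have "permanent R ?b ?a = permanent R (rev ?b) (rev ?a)"
      using permanent_perm_left[of ?b "rev ?b" R ?a] permanent_perm_right[of ?a "rev ?a" R "rev ?b"] by simp
    then show ?thesis unfolding index_even_def map_lab_reverse_antipode by (simp add: len)
  qed
  finally show ?thesis by (simp add: index_even_def)
qed

text \<open>
  The assumption \<open>anti\<close> says that a map with these labels sends the two ends of a diameter to
  disjoint simplices, also after a small perturbation.
\<close>

locale antipodal_labelling =
  fixes n :: nat and \<epsilon> :: real and lab :: "(nat \<Rightarrow> real) \<Rightarrow> 'l" and R :: "'l \<Rightarrow> 'l \<Rightarrow> bool"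
  assumes eps: "\<epsilon> > 0"
    and anti: "\<And>x y. x \<in> l1_sphere n \<Longrightarrow> y \<in> l1_sphere n \<Longrightarrow> nearby \<epsilon> x y \<Longrightarrow> lab x \<noteq> lab (antipode y)"
    and tournament: "\<And>x y. x \<noteq> y \<Longrightarrow> R x y \<noteq> R y x"
begin

definition index_cochain :: "nat \<Rightarrow> (nat \<Rightarrow> real) list \<Rightarrow> bit" where
  "index_cochain p = (if even p then index_even R lab (p div 2) else index_odd R lab (p div 2))"

lemma coboundary_index_cochain:
  assumes "small_chain (l1_sphere n) (Suc (Suc p)) \<epsilon> C" "s \<in> set C"
  shows "coboundary (index_cochain p) s = index_cochain (Suc p) s
      + index_cochain (Suc p) (reverse_antipode s)"
proof -
  have "R (lab x) (lab (antipode y)) \<noteq> R (lab (antipode y)) (lab x)" if "x \<in> set s" "y \<in> set s" for x y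
  proof (rule tournament, rule anti)
  qed (use assms that in \<open>auto simp: small_chain_def\<close>)
  moreover have "length s = Suc (Suc p)" using assms by (simp add: small_chain_def)
  ultimately show ?thesis
    using coboundary_index_even[of s "p div 2" R lab] coboundary_index_odd[of s "p div 2" R lab]
    by (cases "even p") (auto simp: index_cochain_def elim!: oddE evenE)
qed

text \<open>
  The chains \<open>C\<close> of the induction are half-spheres: the next one is a filling of the present
  sphere \<open>C + T C\<close>. Its value telescopes, \<open>\<Phi>\<^sub>p\<^sub>+\<^sub>1 (E + T E) = (\<delta> \<Phi>\<^sub>p) E = \<Phi>\<^sub>p (\<partial> E) = \<Phi>\<^sub>p (C + T
  C)\<close>, down to the value \<open>R (lab x) (lab (-x)) + R (lab (-x)) (lab x) = 1\<close> at a point. This is the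
  Borsuk-Ulam theorem for the given labelling. Each filling enlarges the tuples, so the induction
  starts from a smaller scale.
\<close>

lemma index_cycle:
  assumes "p \<le> n" "\<delta> > 0" "\<delta> \<le> \<epsilon>"
  shows "\<exists>C. small_chain (l1_sphere n) (Suc p) \<delta> C \<and> boundary C \<simeq> [] \<and> pairing (index_cochain p) C = 1"
proof -
  have "\<exists>C. small_chain (l1_sphere n) (Suc p) \<delta> C \<and> boundary (C @ map reverse_antipode C) \<simeq> []
      \<and> pairing (index_cochain p) (C @ map reverse_antipode C) = 1"
    using assms
  proof (induction p arbitrary: \<delta>)
    case 0
    let ?x = "\<lambda>i. if i = 0 then 1 else (0::real)"
    have x: "?x \<in> l1_sphere n" using l1_sphere_unit_vector[of 0 n 1] by simp
    let ?C = "[[?x]]"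
    have "lab ?x \<noteq> lab (antipode ?x)"
      by (rule anti[OF x x]) (use eps in \<open>simp add: nearby_def\<close>)
    from tournament[OF this] have "pairing (index_cochain 0) (?C @ map reverse_antipode ?C) = 1"
      by (auto simp: index_cochain_def index_even_def reverse_antipode_def)
    moreover have "boundary (?C @ map reverse_antipode ?C) \<simeq> []"
      by (simp add: equal_mod2_def boundary_def reverse_antipode_def)
    moreover have "small_chain (l1_sphere n) (Suc 0) \<delta> ?C"
      using x 0 by (simp add: small_chain_def nearby_def)
    ultimately show ?case by blast
  next
    case (Suc p)
    obtain K where K: "K \<ge> 1" and fill: "\<And>\<delta> C. \<delta> > 0 \<Longrightarrow> small_chain (l1_sphere n) (Suc p) \<delta> C \<Longrightarrow>
        boundary C \<simeq> [] \<Longrightarrow> \<exists>E. small_chain (l1_sphere n) (Suc (Suc p)) (K * \<delta>) E \<and> boundary E \<simeq> C"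
      using sphere_filling[OF \<open>Suc p \<le> n\<close>] by blast
    have "\<delta> / K \<le> \<epsilon>" "0 < \<delta> / K" using K Suc.prems by (auto simp: field_simps intro: order_trans)
    with Suc.IH[of "\<delta> / K"] Suc.prems(1) obtain C
      where C: "small_chain (l1_sphere n) (Suc p) (\<delta> / K) C" "boundary (C @ map reverse_antipode C)
          \<simeq> []"
        "pairing (index_cochain p) (C @ map reverse_antipode C) = 1" by auto
    have "small_chain (l1_sphere n) (Suc p) (\<delta> / K) (C @ map reverse_antipode C)"
      using C(1) small_chain_reverse_antipode by simp
    from fill[OF \<open>0 < \<delta> / K\<close> this C(2)] K obtain E
      where E: "small_chain (l1_sphere n) (Suc (Suc p)) \<delta> E" and boundary_E: "boundary E
          \<simeq> C @ map reverse_antipode C" by auto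
    have E\<epsilon>: "small_chain (l1_sphere n) (Suc (Suc p)) \<epsilon> E"
      using E by (rule small_chain_mono) (use Suc.prems in auto)
    have "pairing (index_cochain (Suc p)) (E @ map reverse_antipode E)
        = pairing (coboundary (index_cochain p)) E"
      unfolding pairing_simps(3) pairing_map pairing_add[symmetric]
      by (rule pairing_cong) (simp add: coboundary_index_cochain[OF E\<epsilon>])
    also have "\<dots> = 1"
      using boundary_E C(3) unfolding equal_mod2_def pairing_boundary by simp
    finally have "pairing (index_cochain (Suc p)) (E @ map reverse_antipode E) = 1" .
    moreover have "pairing f (boundary (E @ map reverse_antipode E)) = 0" for f
    proof -
      have "pairing f (boundary (E @ map reverse_antipode E)) = pairing f (boundary E)
          + pairing (\<lambda>s. f (reverse_antipode s)) (boundary E)"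
        by (simp add: boundary_append pairing_boundary pairing_map coboundary_reverse_antipode)
      also have "\<dots> = pairing f (C @ map reverse_antipode C)
          + pairing (\<lambda>s. f (reverse_antipode s)) (C @ map reverse_antipode C)"
        using boundary_E by (simp add: equal_mod2_def)
      also have "\<dots> = 0" by (simp add: pairing_map algebra_simps)
      finally show ?thesis .
    qed
    ultimately show ?case using E by (auto simp: equal_mod2_def)
  qed
  then show ?thesis using small_chain_reverse_antipode by (metis small_chain_append)
qed

end

text \<open>
  With \<open>d + 1\<close> colours, the map described by the labels goes to a complex of dimension \<open>d\<close>.
\<close>

locale coloured_antipodal_labelling = antipodal_labelling n \<epsilon> lab R
  for n \<epsilon> and lab :: "(nat \<Rightarrow> real) \<Rightarrow> 'l" and R +
  fixes col :: "(nat \<Rightarrow> real) \<Rightarrow> nat" and d :: nat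
  assumes col: "\<And>x. x \<in> l1_sphere n \<Longrightarrow> col x \<le> d"
    and same: "\<And>x y. x \<in> l1_sphere n \<Longrightarrow> y \<in> l1_sphere n \<Longrightarrow> nearby \<epsilon> x y \<Longrightarrow> col x = col y \<Longrightarrow> lab x = lab y"
begin

lemma labels_repeat:
  assumes s: "small_chain (l1_sphere n) m \<epsilon> C" "s \<in> set C" and "length t > Suc d" "set t \<subseteq> set s"
  shows "\<not> distinct (map lab t)" "\<not> distinct (map (\<lambda>x. lab (antipode x)) t)"
proof -
  have *: "\<not> distinct (map lab t)"
    if C: "small_chain (l1_sphere n) m \<epsilon> C" "s \<in> set C" and len: "length t > Suc d"
      and sub: "set t \<subseteq> set s" for C s t
  proof
    assume dist: "distinct (map lab t)"
    have mem: "x \<in> l1_sphere n" "nearby \<epsilon> x y" if "x \<in> set t" "y \<in> set t" for x y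
      using that C sub unfolding small_chain_def by blast+
    have "inj_on col (set t)"
    proof (rule inj_onI)
      fix x y assume xy: "x \<in> set t" "y \<in> set t" "col x = col y"
      then have "lab x = lab y" using same mem by blast
      then show "x = y" using dist xy by (auto simp: distinct_map inj_on_def)
    qed
    then have "card (set t) = card (col ` set t)" by (simp add: card_image)
    also have "\<dots> \<le> card {..d}" using col mem by (intro card_mono) auto
    finally show False using dist len by (simp add: distinct_map distinct_card)
  qed
  show "\<not> distinct (map lab t)" using * assms by blast
  have "\<not> distinct (map lab (map antipode t))"
  proof (rule *[OF small_chain_reverse_antipode[OF s(1)]])
    show "reverse_antipode s \<in> set (map reverse_antipode C)" using s(2) by simp
  qed (use assms in \<open>auto simp: reverse_antipode_def\<close>)
  then show "\<not> distinct (map (\<lambda>x. lab (antipode x)) t)" by (simp add: o_def)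
qed

text \<open>
  Sort the tuples of the \<open>2 * d\<close>-cycle \<open>C\<close> by the labels \<open>b\<close> of the antipodes of their back halves. For a given
  list \<open>b\<close> of distinct labels the front halves form a \<open>d\<close>-cycle \<open>D\<close>, the cap product of \<open>C\<close> with
  the cocycle that recognises \<open>b\<close>. It bounds a small chain, and there \<open>permanent R \<dots> b\<close>, as a
  cochain of the front labels, is a cocycle because \<open>d + 2\<close> points of a small tuple cannot have
  distinct labels. Hence \<open>\<Phi>\<^sub>2\<^sub>d\<close> vanishes on each part of \<open>C\<close>.
\<close>

lemma intersection_zero:
  assumes "Suc d \<le> n" "d \<ge> 1"
  obtains \<delta> where "\<delta> > 0" "\<delta> \<le> \<epsilon>"
    "\<And>C. small_chain (l1_sphere n) (Suc (2 * d)) \<delta> C \<Longrightarrow> boundary C \<simeq> []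
        \<Longrightarrow> pairing (index_even R lab d) C = 0"
proof -
  obtain K where K: "K \<ge> 1" and fill: "\<And>\<delta> C. \<delta> > 0 \<Longrightarrow> small_chain (l1_sphere n) (Suc d) \<delta> C \<Longrightarrow>
      boundary C \<simeq> [] \<Longrightarrow> \<exists>E. small_chain (l1_sphere n) (Suc (Suc d)) (K * \<delta>) E \<and> boundary E \<simeq> C"
    using sphere_filling[OF assms(1)] by blast
  define \<delta> where "\<delta> = \<epsilon> / K"
  have \<delta>: "\<delta> > 0" "\<delta> \<le> \<epsilon>" "K * \<delta> = \<epsilon>" using K eps by (auto simp: \<delta>_def field_simps)
  let ?back = "\<lambda>s. map (\<lambda>x. lab (antipode x)) (drop d s)"
  show thesis
  proof (rule that[OF \<delta>(1,2)])
    fix C assume C: "small_chain (l1_sphere n) (Suc (2 * d)) \<delta> C" and cyc: "boundary C \<simeq> []"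
    have C\<epsilon>: "small_chain (l1_sphere n) (Suc (2 * d)) \<epsilon> C"
      using C by (rule small_chain_mono) (use \<delta> in auto)
    have zero: "pairing (\<lambda>s. if mset (?back s) = mset b then index_even R lab d s else 0) C = 0" for b
    proof (cases "distinct b")
      case False
      have "pairing (\<lambda>s. if mset (?back s) = mset b then index_even R lab d s else 0) C
          = pairing (\<lambda>s. 0) C"
      proof (rule pairing_cong)
        fix s assume "s \<in> set C"
        have "index_even R lab d s = 0" if "mset (?back s) = mset b"
          unfolding index_even_def using False mset_eq_imp_distinct_iff[OF that]
          by (intro permanent_nondistinct_right) auto
        then show "(if mset (?back s) = mset b then index_even R lab d s else 0) = 0" by simp
      qed
      then show ?thesis by simp
    next
      case True
      define D where "D = map (take (Suc d)) (filter (\<lambda>s. mset (?back s) = mset b) C)"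
      let ?c = "\<lambda>t. of_bool (mset t = mset b) :: bit"
      have c_alt: "?c t = 0" if "\<not> distinct t" for t
        using that True mset_eq_imp_distinct_iff by fastforce
      have "pairing f (boundary D) = 0" for f
      proof -
        obtain e where e: "d = Suc e" using \<open>d \<ge> 1\<close> by (cases d) auto
        let ?c' = "\<lambda>t. ?c (map (\<lambda>x. lab (antipode x)) t)"
        let ?K = "\<lambda>a b. ?c' b * f a"
        have "pairing f (boundary D) = pairing (\<lambda>s. ?c' (drop d s) * coboundary f (take (Suc d) s)) C"
          unfolding D_def pairing_boundary pairing_map pairing_filter by (rule pairing_cong) simp
        also have "\<dots> = pairing (coboundary (\<lambda>u. ?K (take (Suc e) u) (drop e u))) C"
        proof (rule pairing_cong)
          fix s assume s: "s \<in> set C"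
          then have len: "length s = Suc (2 * d)" using C by (simp add: small_chain_def)
          have "coboundary ?c' (drop e s) = coboundary ?c (map (\<lambda>x. lab (antipode x)) (drop e s))"
            by (simp add: deletion_sum_map)
          also have "\<dots> = 0"
          proof (rule coboundary_alternating_nondistinct)
            show "\<not> distinct (map (\<lambda>x. lab (antipode x)) (drop e s))"
              by (rule labels_repeat(2)[OF C\<epsilon> s]) (auto simp: len e dest: in_set_dropD)
          qed (use c_alt in auto)
          finally have 0: "coboundary ?c' (drop e s) = 0" .
          have "coboundary (\<lambda>u. ?K (take (Suc e) u) (drop e u)) s
              = coboundary (\<lambda>a. ?K a (drop (Suc e) s)) (take (Suc (Suc e)) s)
                + coboundary (\<lambda>b. ?K (take (Suc e) s) b) (drop e s)"
            by (rule coboundary_kernel[where K = ?K]) (simp add: len e)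
          also have "\<dots> = ?c' (drop (Suc e) s) * coboundary f (take (Suc (Suc e)) s)"
            unfolding deletion_sum_mult_right deletion_sum_mult 0 by simp
          finally show "?c' (drop d s) * coboundary f (take (Suc d) s)
              = coboundary (\<lambda>u. ?K (take (Suc e) u) (drop e u)) s"
            by (simp add: e)
        qed
        also have "\<dots> = 0" using cyc unfolding equal_mod2_def pairing_boundary by simp
        finally show ?thesis .
      qed
      then have "boundary D \<simeq> []" by (simp add: equal_mod2_def)
      moreover have "small_chain (l1_sphere n) (Suc d) \<delta> D"
        unfolding small_chain_def
      proof
        fix t assume "t \<in> set D"
        then obtain s where s: "s \<in> set C" "t = take (Suc d) s" by (auto simp: D_def)
        have "length s = Suc (2 * d)" "set s \<subseteq> l1_sphere n" "\<forall>x\<in>set s. \<forall>y\<in>set s. nearby \<delta> x y"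
          using C s(1) by (auto simp: small_chain_def)
        then show "length t = Suc d \<and> set t \<subseteq> l1_sphere n \<and> (\<forall>x\<in>set t. \<forall>y\<in>set t. nearby \<delta> x y)"
          using set_take_subset[of "Suc d" s] unfolding s(2) by auto
      qed
      ultimately obtain E where E: "small_chain (l1_sphere n) (Suc (Suc d)) \<epsilon> E" and boundary_E:
          "boundary E \<simeq> D"
        using fill[OF \<delta>(1)] \<delta>(3) by metis
      have "pairing (\<lambda>s. if mset (?back s) = mset b then index_even R lab d s else 0) C
          = pairing (\<lambda>t. permanent R (map lab t) b) D"
        unfolding D_def pairing_map pairing_filter index_even_def
        by (rule pairing_cong) (use permanent_perm_right[of "?back _" b R] in auto)
      also have "\<dots> = pairing (coboundary (\<lambda>t. permanent R (map lab t) b)) E"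
        using boundary_E unfolding equal_mod2_def pairing_boundary by simp
      also have "\<dots> = pairing (\<lambda>s. 0) E"
      proof (rule pairing_cong)
        fix s assume s: "s \<in> set E"
        then have len: "length s = Suc (Suc d)" using E by (simp add: small_chain_def)
        have "coboundary (\<lambda>t. permanent R (map lab t) b) s
            = coboundary (\<lambda>t. permanent R t b) (map lab s)"
          by (simp add: deletion_sum_map)
        also have "\<dots> = 0"
        proof (rule coboundary_alternating_nondistinct)
          show "\<not> distinct (map lab s)"
            by (rule labels_repeat(1)[OF E s]) (auto simp: len)
        qed (auto intro: permanent_perm_left permanent_nondistinct_left)
        finally show "coboundary (\<lambda>t. permanent R (map lab t) b) s = 0" .
      qed
      finally show ?thesis by simp
    qed
    define MS where "MS = (\<lambda>s. mset (?back s)) ` set C"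
    have "pairing (index_even R lab d) C
        = pairing (\<lambda>s. \<Sum>M\<in>MS. if mset (?back s) = M then index_even R lab d s else 0) C"
      by (rule pairing_cong) (auto simp: MS_def)
    also have "\<dots> = 0"
      unfolding pairing_sum
    proof (intro sum.neutral ballI)
      fix M assume "M \<in> MS"
      then obtain s where M: "M = mset (?back s)" unfolding MS_def by blast
      show "pairing (\<lambda>s. if mset (?back s) = M then index_even R lab d s else 0) C = 0"
        unfolding M by (rule zero)
    qed
    finally show "pairing (index_even R lab d) C = 0" .
  qed
qed

text \<open>
  For \<open>d = 0\<close> a zero-dimensional cycle is replaced by a one-dimensional one: on an edge both
  labels are equal, while \<open>\<Phi>\<^sub>1\<close> alternates in the two front labels.
\<close>

theorem dimension_bound:
  assumes "n \<ge> 1"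
  shows "n < 2 * d"
proof (rule ccontr)
  assume "\<not> n < 2 * d"
  then have n: "2 * d \<le> n" by simp
  show False
  proof (cases "d = 0")
    case True
    obtain C where C: "small_chain (l1_sphere n) (Suc 1) \<epsilon> C" "pairing (index_cochain 1) C = 1"
      using index_cycle[of 1 \<epsilon>] assms eps by auto
    have "pairing (index_cochain 1) C = pairing (\<lambda>s. 0) C"
    proof (rule pairing_cong)
      fix s assume s: "s \<in> set C"
      then have len: "length s = 2" using C by (simp add: small_chain_def)
      have "\<not> distinct (map lab (take 2 s))"
        by (rule labels_repeat(1)[OF C(1) s]) (auto simp: len True)
      then show "index_cochain 1 s = 0"
        unfolding index_cochain_def index_odd_def
        by (auto intro!: coboundary_alternating_nondistinct permanent_perm_left
            permanent_nondistinct_left simp: numeral_2_eq_2)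
    qed
    then show False using C(2) by simp
  next
    case False
    then have "Suc d \<le> n" "d \<ge> 1" using n by auto
    then obtain \<delta> where "\<delta> > 0" "\<delta> \<le> \<epsilon>" and zero:
      "\<And>C. small_chain (l1_sphere n) (Suc (2 * d)) \<delta> C \<Longrightarrow> boundary C \<simeq> []
          \<Longrightarrow> pairing (index_even R lab d) C = 0"
      by (rule intersection_zero) (rule that; blast)
    with index_cycle[OF n, of \<delta>] show False by (auto simp: index_cochain_def)
  qed
qed

end

section \<open>Labelling the sphere by an open cover\<close>

abbreviation sphere_set :: "nat \<Rightarrow> (nat \<Rightarrow> real) set" where
  "sphere_set n \<equiv> {x. (\<Sum>i\<le>n. x i ^ 2) = 1 \<and> (\<forall>i>n. x i = 0)}"

lemma nsphere_top_of_set: "nsphere n = top_of_set (sphere_set n)"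
  by (simp add: nsphere euclidean_product_topology)

lemma continuous_on_coordinate [continuous_intros]: "continuous_on S (\<lambda>x :: nat \<Rightarrow> real. x i)"
  by (rule continuous_on_subset[OF continuous_on_product_coordinates]) simp

definition normalise :: "nat \<Rightarrow> (nat \<Rightarrow> real) \<Rightarrow> nat \<Rightarrow> real" where
  "normalise n y = (\<lambda>i. if i \<le> n then y i / sqrt (\<Sum>j\<le>n. y j ^ 2) else 0)"

abbreviation nonzero :: "nat \<Rightarrow> (nat \<Rightarrow> real) set" where
  "nonzero n \<equiv> {y. (\<Sum>j\<le>n. y j ^ 2) > 0}"

lemma normalise_in_sphere: 
  assumes "y \<in> nonzero n"
  shows "normalise n y \<in> sphere_set n"
proof -
  have "(\<Sum>i\<le>n. (normalise n y i)\<^sup>2) = (\<Sum>i\<le>n. (y i)\<^sup>2 / (\<Sum>j\<le>n. (y j)\<^sup>2))"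
    by (rule sum.cong) (use assms in \<open>auto simp: normalise_def power_divide\<close>)
  also have "\<dots> = 1" using assms by (simp add: sum_divide_distrib[symmetric])
  finally show ?thesis by (simp add: normalise_def)
qed

lemma normalise_antipode: "normalise n (antipode y) = antipode (normalise n y)"
  by (auto simp: normalise_def antipode_def)

lemma continuous_on_normalise: "continuous_on (nonzero n) (normalise n)"
proof (rule continuous_on_coordinatewise_then_product)
  fix i
  show "continuous_on (nonzero n) (\<lambda>x. normalise n x i)"
    by (cases "i \<le> n") (auto simp: normalise_def intro!: continuous_intros)
qed

lemma nearby_imp_dist_le:
  fixes x y :: "nat \<Rightarrow> real"
  assumes "nearby \<epsilon> x y"
  shows "dist x y \<le> 2 * \<epsilon>"
proof -
  have le: "(1/2)^i * min (dist (x (from_nat i)) (y (from_nat i))) 1 \<le> (1/2)^i * \<epsilon>" for i :: nat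
    using assms by (intro mult_left_mono) (auto simp: nearby_def dist_real_def min.coboundedI1)
  have sum: "summable (\<lambda>i. (1/2::real)^i * \<epsilon>)"
    by (intro summable_mult2) simp
  have "dist x y \<le> (\<Sum>i. (1/2)^i * \<epsilon>)"
    unfolding dist_fun_def
  proof (rule suminf_le[OF le _ sum])
    show "summable (\<lambda>i. (1/2)^i * min (dist (x (from_nat i)) (y (from_nat i))) 1)"
      by (rule summable_comparison_test'[OF sum, of 0]) (use le in simp)
  qed
  also have "\<dots> = 2 * \<epsilon>"
    using suminf_mult2[of "\<lambda>i. (1/2::real)^i" \<epsilon>] suminf_geometric[of "1/2::real"] by simp
  finally show ?thesis .
qed

lemma compact_l1_sphere: "compact (l1_sphere n)"
proof -
  have "compactin (product_topology (\<lambda>i. euclidean) UNIV) (PiE UNIV (\<lambda>i::nat. {-1..1::real}))"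
    by (simp add: compactin_PiE)
  then have "compact (PiE UNIV (\<lambda>i::nat. {-1..1::real}))"
    by (simp add: euclidean_product_topology)
  moreover have "closed (l1_sphere n)"
    unfolding l1_sphere_def Collect_conj_eq
    by (intro closed_Int closed_Collect_eq closed_Collect_all closed_Collect_imp continuous_intros) auto
  moreover have "l1_sphere n \<subseteq> PiE UNIV (\<lambda>i. {-1..1})"
    using l1_sphere_abs_le_1 by (fastforce simp: abs_le_iff)
  ultimately show ?thesis using compact_Int_closed by (metis inf.absorb2)
qed

text \<open>
  Lebesgue's number lemma for the cover of the cross-polytope by the cones over the \<open>U i\<close>. The
  neighbourhoods are taken in the space of all sequences rather than in the cross-polytope, so
  that straight segments between close points can be used.
\<close>

lemma uniform_cover:
  assumes "open_cover_of_sphere n k U"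
  obtains \<epsilon> where "\<epsilon> > 0"
    "\<And>x. x \<in> l1_sphere n \<Longrightarrow> \<exists>i<k. \<forall>y. nearby \<epsilon> x y \<longrightarrow> y \<in> nonzero n \<and> normalise n y \<in> U i"
proof -
  define G where "G i = {y \<in> nonzero n. normalise n y \<in> U i}" for i
  have nz: "open (nonzero n)" by (intro open_Collect_less continuous_intros)
  have G: "open (G i)" if "i < k" for i
  proof -
    have "openin (top_of_set (sphere_set n)) (U i)"
      using assms that unfolding open_cover_of_sphere_def nsphere_top_of_set by blast
    then obtain T where T: "open T" "U i = sphere_set n \<inter> T"
      unfolding openin_open by (elim exE conjE) (rule that)
    have "G i = normalise n -` T \<inter> nonzero n"
      using normalise_in_sphere T(2) by (auto simp: G_def)
    then show ?thesis
      using continuous_on_open_vimage[OF nz] continuous_on_normalise T(1) by metis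
  qed
  have l1_nonzero: "x \<in> nonzero n" if "x \<in> l1_sphere n" for x
  proof -
    have "(\<Sum>i\<le>n. (x i)\<^sup>2) \<noteq> 0"
    proof
      assume "(\<Sum>i\<le>n. (x i)\<^sup>2) = 0"
      then have "x i = 0" if "i \<le> n" for i using that by (simp add: sum_nonneg_eq_0_iff)
      then show False using \<open>x \<in> l1_sphere n\<close> by (simp add: l1_sphere_def)
    qed
    then show ?thesis using sum_nonneg[of "{..n}" "\<lambda>i. (x i)\<^sup>2"] by auto
  qed
  have "\<exists>i r. i < k \<and> r > 0 \<and> ball x (2 * r) \<subseteq> G i" if "x \<in> l1_sphere n" for x
  proof -
    have "normalise n x \<in> (\<Union>i<k. U i)"
      using assms normalise_in_sphere[OF l1_nonzero[OF that]]
      by (simp add: open_cover_of_sphere_def nsphere_top_of_set)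
    then obtain i where i: "i < k" "x \<in> G i" using l1_nonzero[OF \<open>x \<in> l1_sphere n\<close>]
        by (auto simp: G_def)
    then obtain e where "e > 0" "ball x e \<subseteq> G i" using G open_contains_ball by blast
    then show ?thesis using i(1) by (intro exI[of _ i] exI[of _ "e / 2"]) auto
  qed
  then obtain I r where Ir: "\<And>x. x \<in> l1_sphere n \<Longrightarrow> I x < k \<and> r x > 0 \<and> ball x (2 * r x) \<subseteq> G (I x)"
    by metis
  obtain F where F: "F \<subseteq> l1_sphere n" "finite F" "l1_sphere n \<subseteq> (\<Union>x\<in>F. ball x (r x))"
  proof (rule compactE_image[OF compact_l1_sphere, of "l1_sphere n" "\<lambda>x. ball x (r x)" n])
    show "l1_sphere n \<subseteq> (\<Union>x\<in>l1_sphere n. ball x (r x))" using Ir by force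
  qed auto
  define \<epsilon> where "\<epsilon> = Min (insert 1 (r ` F)) / 4"
  have \<epsilon>: "\<epsilon> > 0" and \<epsilon>_le: "\<And>x. x \<in> F \<Longrightarrow> 2 * \<epsilon> < r x"
  proof -
    let ?m = "Min (insert 1 (r ` F))"
    have "?m > 0" using F Ir by (subst Min_gr_iff) auto
    moreover have "?m \<le> r x" if "x \<in> F" for x using that F(2) by (intro Min_le) auto
    ultimately show "\<epsilon> > 0" "\<And>x. x \<in> F \<Longrightarrow> 2 * \<epsilon> < r x"
      by (simp_all add: \<epsilon>_def) (smt (verit) that)
  qed
  show thesis
  proof (rule that[OF \<epsilon>])
    fix x assume "x \<in> l1_sphere n"
    then obtain z where z: "z \<in> F" "dist z x < r z" using F(3) by (auto simp: mem_ball)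
    have "y \<in> G (I z)" if "nearby \<epsilon> x y" for y
    proof -
      have "dist z y \<le> dist z x + dist x y" by (rule dist_triangle)
      also have "\<dots> < 2 * r z"
        using z nearby_imp_dist_le[OF that] \<epsilon>_le[OF z(1)] by linarith
      finally show ?thesis using Ir[of z] z(1) F(1) by (auto simp: subset_iff)
    qed
    then show "\<exists>i<k. \<forall>y. nearby \<epsilon> x y \<longrightarrow> y \<in> nonzero n \<and> normalise n y \<in> U i"
      using Ir[of z] z(1) F(1) by (intro exI[of _ "I z"]) (auto simp: G_def)
  qed
qed

text \<open>
  The radial projection of the segment between two close points stays in the set that gives the
  first one its colour. So equal colours give equal path components, and if \<open>x\<close> had the same label
  as \<open>-y\<close> for some \<open>y\<close> near \<open>x\<close>, the set would contain a path from \<open>y\<close> through \<open>x\<close> to \<open>-y\<close>.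
\<close>

theorem cover_dimension_bound:
  assumes "n \<ge> 1" and cover: "open_cover_of_sphere n k U"
    and no_path: "\<And>i. i < k \<Longrightarrow> \<not> contains_antipodally_connecting_path n (U i)"
  shows "n < 2 * (k - 1)"
proof -
  obtain \<epsilon> where \<epsilon>: "\<epsilon> > 0" and U\<epsilon>: "\<And>x. x \<in> l1_sphere n \<Longrightarrow>
      \<exists>i<k. \<forall>y. nearby \<epsilon> x y \<longrightarrow> y \<in> nonzero n \<and> normalise n y \<in> U i"
    by (rule uniform_cover[OF cover]) (rule that)
  then obtain col where col: "\<And>x. x \<in> l1_sphere n \<Longrightarrow> col x < k" and
    colU: "\<And>x y. x \<in> l1_sphere n \<Longrightarrow> nearby \<epsilon> x y \<Longrightarrow> y \<in> nonzero n \<and> normalise n y \<in> U (col x)"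
    by metis
  define X where "X i = top_of_set (sphere_set n \<inter> U i)" for i
  define lab where "lab x = (col x, path_component_of_set (X (col x)) (normalise n x))" for x
  have segment: "path_component_of (X (col x)) (normalise n x) (normalise n y)"
    if x: "x \<in> l1_sphere n" and xy: "nearby \<epsilon> x y" for x y
  proof -
    define p where "p t = (\<lambda>i. x i + t * (y i - x i))" for t :: real
    have near: "nearby \<epsilon> x (p t)" if "t \<in> {0..1}" for t
      unfolding nearby_def
    proof
      fix i
      have "\<bar>x i - p t i\<bar> = t * \<bar>x i - y i\<bar>"
        using that by (simp add: p_def abs_mult abs_minus_commute)
      also have "\<dots> \<le> \<bar>x i - y i\<bar>" using that by (simp add: mult_left_le_one_le)
      also have "\<dots> \<le> \<epsilon>" using xy by (simp add: nearby_def)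
      finally show "\<bar>x i - p t i\<bar> \<le> \<epsilon>" .
    qed
    have "continuous_on {0..1} p"
      unfolding p_def by (intro continuous_on_coordinatewise_then_product continuous_intros)
    moreover have "p ` {0..1} \<subseteq> nonzero n" using colU[OF x near] by blast
    ultimately have "continuous_on {0..1} (\<lambda>t. normalise n (p t))"
      by (rule continuous_on_compose2[OF continuous_on_normalise])
    moreover have "normalise n (p t) \<in> sphere_set n \<inter> U (col x)" if "t \<in> {0..1}" for t
      using colU[OF x near[OF that]] normalise_in_sphere by blast
    ultimately have "pathin (X (col x)) (\<lambda>t. normalise n (p t))"
      unfolding X_def pathin_canon_iff path_def by auto
    moreover have "p 0 = x" "p 1 = y" by (auto simp: p_def)
    ultimately show ?thesis unfolding path_component_of_def by metis
  qed
  have near_self: "nearby \<epsilon> x x" for x using \<epsilon> by (simp add: nearby_def)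
  obtain R :: "nat \<times> (nat \<Rightarrow> real) set \<Rightarrow> nat \<times> (nat \<Rightarrow> real) set \<Rightarrow> bool"
    where R: "\<And>x y. x \<noteq> y \<Longrightarrow> R x y \<noteq> R y x"
    using tournament_exists by metis
  interpret coloured_antipodal_labelling n \<epsilon> lab R col "k - 1"
  proof
    show "\<epsilon> > 0" by fact
    show "R x y \<noteq> R y x" if "x \<noteq> y" for x y using R that .
    show "col x \<le> k - 1" if "x \<in> l1_sphere n" for x using col[OF that] by simp
    show "lab x = lab y" if "x \<in> l1_sphere n" "nearby \<epsilon> x y" "col x = col y" for x y
    proof -
      have "path_component_of (X (col x)) (normalise n x) z
          \<longleftrightarrow> path_component_of (X (col x)) (normalise n y) z" for z
        using segment[OF that(1,2)] path_component_of_trans path_component_of_sym by metis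
      then have "path_component_of (X (col x)) (normalise n x)
          = path_component_of (X (col x)) (normalise n y)" by (rule ext)
      then show ?thesis using that(3) by (simp add: lab_def)
    qed
    show "lab x \<noteq> lab (antipode y)"
        if x: "x \<in> l1_sphere n" and y: "y \<in> l1_sphere n" and "nearby \<epsilon> x y" for x y
    proof
      assume eq: "lab x = lab (antipode y)"
      let ?i = "col x"
      have "path_component_of (X ?i) (normalise n (antipode y)) (normalise n (antipode y))"
        using segment[OF antipode_in_l1_sphere[OF y] near_self] eq by (simp add: lab_def)
      then have "path_component_of (X ?i) (normalise n x) (antipode (normalise n y))"
        using eq by (auto simp: lab_def set_eq_iff normalise_antipode)
      then have "path_component_of (X ?i) (normalise n y) (antipode (normalise n y))"
        using segment[OF x \<open>nearby \<epsilon> x y\<close>] path_component_of_trans path_component_of_sym by metis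
      then obtain g where g: "pathin (X ?i) g" "g 0 = normalise n y" "g 1 = antipode (normalise n y)"
        unfolding path_component_of_def by blast
      then have "pathin (nsphere n) g" "g ` {0..1} \<subseteq> U ?i"
        by (auto simp: X_def nsphere_top_of_set pathin_canon_iff)
      with g have "contains_antipodally_connecting_path n (U ?i)"
        unfolding contains_antipodally_connecting_path_def by auto
      then show False using no_path col[OF x] by blast
    qed
  qed
  show ?thesis by (rule dimension_bound[OF \<open>n \<ge> 1\<close>])
qed

section \<open>A cover without antipodally connecting paths\<close>

text \<open>
  Consider the three forms \<open>a\<close>, \<open>b\<close>, \<open>-a - b\<close> on the plane, with sum zero. The value \<open>tripod a b
  j\<close> is the excess of the form \<open>j\<close> over the larger of the other two. It is positive on one of
  three sectors of the plane, and folds this sector onto one ray of a tripod; the boundaries of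
  the sectors go to the centre.
\<close>

definition tripod :: "real \<Rightarrow> real \<Rightarrow> nat \<Rightarrow> real" where
  "tripod a b j =
     (if j = 0 then a - max b (- a - b) else if j = 1 then b - max (- a - b) a else - a - b - max a b)"

lemma tripod_unique: "tripod a b i > 0 \<Longrightarrow> tripod a b j > 0 \<Longrightarrow> i < 3 \<Longrightarrow> j < 3 \<Longrightarrow> i = j"
  by (auto simp: tripod_def max_def split: if_splits)

lemma tripod_antipodal: "tripod a b j > 0 \<Longrightarrow> tripod (- a) (- b) j \<le> 0"
  by (auto simp: tripod_def max_def split: if_splits)

text \<open>
  On the boundary of a sector two forms share the largest value. Unless all three are zero, the
  third is the strictly smallest, so it is the strictly largest one at the antipode.
\<close>

lemma tripod_cover:
  assumes "a \<noteq> 0 \<or> b \<noteq> 0" "\<And>j. j < 3 \<Longrightarrow> tripod a b j \<le> 0"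
  shows "\<exists>j<3. tripod (- a) (- b) j > 0"
proof (rule ccontr)
  assume "\<not> ?thesis"
  then have *: "tripod (- a) (- b) j \<le> 0" if "j < 3" for j
    using that not_less by blast
  from *[of 0] *[of 1] *[of 2] assms(1) assms(2)[of 0] assms(2)[of 1] assms(2)[of 2] show False
    by (auto simp: tripod_def max_def split: if_splits)
qed

text \<open>
  The index \<open>(m, j)\<close> stands for the sector \<open>j\<close> of the plane of the coordinates \<open>2 * m\<close> and \<open>2 * m
  + 1\<close>.
\<close>

definition depth :: "(nat \<Rightarrow> real) \<Rightarrow> nat \<times> nat \<Rightarrow> real" where
  "depth x p = tripod (x (2 * fst p)) (x (2 * fst p + 1)) (snd p)"

lemma continuous_on_depth [continuous_intros]: "continuous_on S (\<lambda>x. depth x p)"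
  unfolding depth_def tripod_def
  by (cases "snd p = 0"; cases "snd p = 1") (auto intro!: continuous_intros)

lemma continuous_on_depth_antipode [continuous_intros]: "continuous_on S (\<lambda>x. depth (antipode x) p)"
  unfolding depth_def tripod_def antipode_def
  by (cases "snd p = 0"; cases "snd p = 1") (auto intro!: continuous_intros)

lemma depth_antipode: "depth x p > 0 \<Longrightarrow> depth (antipode x) p \<le> 0"
  by (simp add: depth_def antipode_def tripod_antipodal)

text \<open>
  The sectors in \<open>I\<close> are entered, and more deeply than all the other sectors. In the product of
  the tripods these points form a neighbourhood of the interior of one cell, the product of the
  rays listed in \<open>I\<close>.
\<close>

definition top_cell :: "(nat \<times> nat) set \<Rightarrow> (nat \<times> nat) set \<Rightarrow> (nat \<Rightarrow> real) set" where
  "top_cell P I = {x. \<forall>p\<in>I. 0 < depth x p \<and> (\<forall>q\<in>P - I. depth x q < depth x p)}"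

lemma open_top_cell:
  assumes "finite P" "I \<subseteq> P"
  shows "open (top_cell P I)"
proof -
  have "top_cell P I = (\<Inter>p\<in>I. {x. 0 < depth x p} \<inter> (\<Inter>q\<in>P - I. {x. depth x q < depth x p}))"
    by (auto simp: top_cell_def)
  moreover have "finite I" using assms finite_subset by blast
  ultimately show ?thesis
    using assms(1) by (auto intro!: open_INT open_Int open_Collect_less continuous_intros)
qed

text \<open>
  Two different sets of the same size each have an element outside the other, and these two
  elements would each have to be deeper than the other.
\<close>

lemma top_cell_disjoint:
  assumes "finite P" "I \<subseteq> P" "J \<subseteq> P" "card I = card J" "x \<in> top_cell P I" "x \<in> top_cell P J"
  shows "I = J"
proof (rule ccontr)
  assume "I \<noteq> J"
  have "finite I" "finite J" using assms finite_subset by blast+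
  then have "\<not> I \<subseteq> J" "\<not> J \<subseteq> I"
    using \<open>I \<noteq> J\<close> assms(4) card_subset_eq by metis+
  then obtain p q where "p \<in> I - J" "q \<in> J - I" by blast
  then have "depth x q < depth x p" "depth x p < depth x q"
    using assms by (auto simp: top_cell_def)
  then show False by simp
qed

lemma path_in_disjoint_open_union:
  fixes g :: "real \<Rightarrow> 'a::topological_space"
  assumes g: "continuous_on {0..1} g" "g ` {0..1} \<subseteq> \<Union>\<V>"
    and "\<And>V. V \<in> \<V> \<Longrightarrow> open V" and disj: "\<And>V W. V \<in> \<V> \<Longrightarrow> W \<in> \<V> \<Longrightarrow> V \<inter> W \<noteq> {} \<Longrightarrow> V = W"
  shows "\<exists>V\<in>\<V>. g ` {0..1} \<subseteq> V"
proof -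
  have "connected (g ` {0..1})" by (rule connected_continuous_image[OF g(1)]) simp
  have g0: "g 0 \<in> g ` {0..1}" by simp
  then obtain V where V: "V \<in> \<V>" "g 0 \<in> V" using g(2) by blast
  have "open V" "open (\<Union>(\<V> - {V}))" using assms(3) V(1) by auto
  moreover have "V \<inter> \<Union>(\<V> - {V}) \<inter> g ` {0..1} = {}" using disj V(1) by blast
  moreover have "g ` {0..1} \<subseteq> V \<union> \<Union>(\<V> - {V})" using g(2) by blast
  ultimately have "V \<inter> g ` {0..1} = {} \<or> \<Union>(\<V> - {V}) \<inter> g ` {0..1} = {}"
    using \<open>connected (g ` {0..1})\<close> unfolding connected_def by blast
  then have "\<Union>(\<V> - {V}) \<inter> g ` {0..1} = {}" using g0 V(2) by blast
  then have "g ` {0..1} \<subseteq> V" using g(2) by blast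
  then show ?thesis using V(1) by blast
qed

text \<open>
  For \<open>i \<ge> 1\<close> the set \<open>U i\<close> is the disjoint union of the open sets \<open>top_cell P I\<close> with \<open>card I =
  i\<close>, so a path in \<open>U i\<close> keeps \<open>I\<close> fixed, while \<open>x\<close> and \<open>-x\<close> never share a sector. A point in some
  sector belongs to the \<open>top_cell\<close> of the set of its sectors, which has at most \<open>d\<close> elements, at
  most one in each plane. The remaining points lie in no sector, but their antipodes do. They
  belong to \<open>U 0\<close>, the open set of points whose antipodes reach deeper than they do themselves,
  which contains no antipodal pair.
\<close>

theorem sharp_cover:
  assumes "n < 2 * d"
  shows "\<exists>U. open_cover_of_sphere n (Suc d) U \<and>
    (\<forall>i<Suc d. \<not> contains_antipodally_connecting_path n (U i))"
proof -
  define P where "P = {..<d} \<times> {..<3::nat}"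
  have fin: "finite P" by (simp add: P_def)
  define cells where "cells i = top_cell P ` {I. I \<subseteq> P \<and> card I = i}" for i
  define Z where "Z = {x. \<exists>q\<in>P. \<forall>p\<in>P. depth x p < depth (antipode x) q}"
  define U where "U i = sphere_set n \<inter> (if i = 0 then Z else \<Union>(cells i))" for i
  have cells_open: "open V" if "V \<in> cells i" for V i
    using that open_top_cell[OF fin] by (auto simp: cells_def)
  have "Z = (\<Union>q\<in>P. \<Inter>p\<in>P. {x. depth x p < depth (antipode x) q})"
    by (auto simp: Z_def)
  then have "open Z"
    using fin by (auto intro!: open_UN open_INT open_Collect_less continuous_intros)
  then have openU: "openin (nsphere n) (U i)" for i
    using cells_open unfolding nsphere_top_of_set U_def by (auto intro!: openin_open_Int)
  have "x \<in> (\<Union>i<Suc d. U i)" if x: "x \<in> sphere_set n" for x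
  proof -
    define I where "I = {p \<in> P. depth x p > 0}"
    have IP: "I \<subseteq> P" by (auto simp: I_def)
    show ?thesis
    proof (cases "I = {}")
      case True
      have "\<exists>i\<le>n. x i \<noteq> 0"
      proof (rule ccontr)
        assume "\<not> ?thesis"
        then have "(\<Sum>i\<le>n. x i ^ 2) = 0" by simp
        then show False using x by simp
      qed
      then obtain i where i: "i \<le> n" "x i \<noteq> 0" by blast
      define m where "m = i div 2"
      have "i = 2 * m \<or> i = 2 * m + 1" unfolding m_def by presburger
      then have "x (2 * m) \<noteq> 0 \<or> x (2 * m + 1) \<noteq> 0" using i(2) by auto
      moreover have "m < d" using i(1) assms by (simp add: m_def)
      then have le: "depth x (m, j) \<le> 0" if "j < 3" for j
        using True that by (force simp: I_def P_def not_less)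
      ultimately obtain j where j: "j < 3" "depth (antipode x) (m, j) > 0"
        using tripod_cover[of "x (2 * m)" "x (2 * m + 1)"] by (auto simp: depth_def antipode_def)
      have "depth x p \<le> 0" if "p \<in> P" for p
        using True that not_less unfolding I_def by blast
      then have "x \<in> Z" unfolding Z_def using j \<open>m < d\<close>
        by (intro CollectI bexI[of _ "(m, j)"]) (force simp: P_def)+
      then show ?thesis using x by (force simp: U_def)
    next
      case False
      have "finite I" using IP fin finite_subset by blast
      then have "card I \<noteq> 0" using False by simp
      have "inj_on fst I"
        by (auto simp: inj_on_def I_def P_def depth_def dest: tripod_unique)
      moreover have "fst ` I \<subseteq> {..<d}" using IP by (auto simp: P_def)
      ultimately have "card I \<le> d" using card_inj_on_le[of fst I "{..<d}"] by simp
      moreover have "x \<in> top_cell P I" by (force simp: top_cell_def I_def not_less)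
      then have "x \<in> U (card I)"
        using \<open>card I \<noteq> 0\<close> IP x by (auto simp: U_def cells_def)
      ultimately show ?thesis by auto
    qed
  qed
  then have "(\<Union>i<Suc d. U i) = topspace (nsphere n)"
    by (auto simp: U_def nsphere_top_of_set)
  moreover have "\<not> contains_antipodally_connecting_path n (U i)" for i
  proof
    assume "contains_antipodally_connecting_path n (U i)"
    then obtain g where g: "pathin (nsphere n) g" "g ` {0..1} \<subseteq> U i" "g 1 = antipode (g 0)"
      unfolding contains_antipodally_connecting_path_def by blast
    have ends: "g 0 \<in> g ` {0..1}" "antipode (g 0) \<in> g ` {0..1}"
      unfolding g(3)[symmetric] by simp_all
    then have in_U: "g 0 \<in> U i" "antipode (g 0) \<in> U i" using g(2) by blast+
    show False
    proof (cases "i = 0")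
      case True
      with in_U have "g 0 \<in> Z" "antipode (g 0) \<in> Z" by (auto simp: U_def)
      then obtain q r where "q \<in> P" "r \<in> P"
        "depth (g 0) r < depth (antipode (g 0)) q" "depth (antipode (g 0)) q < depth (g 0) r"
        unfolding Z_def mem_Collect_eq antipode_antipode by blast
      then show False by simp
    next
      case False
      have "continuous_on {0..1} g"
        using g(1) unfolding nsphere_top_of_set pathin_canon_iff path_def by blast
      moreover have "g ` {0..1} \<subseteq> \<Union>(cells i)" using g(2) False by (auto simp: U_def)
      ultimately have "\<exists>V\<in>cells i. g ` {0..1} \<subseteq> V"
      proof (rule path_in_disjoint_open_union)
        show "open V" if "V \<in> cells i" for V using cells_open that .
        show "V = W" if VW: "V \<in> cells i" "W \<in> cells i" "V \<inter> W \<noteq> {}" for V W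
        proof -
          have "\<exists>I. V = top_cell P I \<and> I \<subseteq> P \<and> card I = i" if "V \<in> cells i" for V
            using that by (auto simp: cells_def)
          from this[OF VW(1)] this[OF VW(2)] obtain I J
            where I: "V = top_cell P I" "I \<subseteq> P" "card I = i"
              and J: "W = top_cell P J" "J \<subseteq> P" "card J = i" by metis
          obtain x where "x \<in> V" "x \<in> W" using VW(3) by blast
          then show ?thesis using top_cell_disjoint[OF fin, of I J x] I J by simp
        qed
      qed
      then obtain I where I: "I \<subseteq> P" "card I = i" "g ` {0..1} \<subseteq> top_cell P I"
        by (auto simp: cells_def)
      then have "I \<noteq> {}" using False by auto
      then obtain p where "p \<in> I" by blast
      moreover have "g 0 \<in> top_cell P I" "antipode (g 0) \<in> top_cell P I"
        using I(3) ends by blast+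
      ultimately have "depth (g 0) p > 0" "depth (antipode (g 0)) p > 0"
        by (auto simp: top_cell_def)
      then show False using depth_antipode[of "g 0" p] by simp
    qed
  qed
  ultimately show ?thesis using openU unfolding open_cover_of_sphere_def by blast
qed

theorem theorem1:
  fixes n k :: nat
  shows "(n \<ge> 1 \<and> int n \<ge> 2 * int k - 2 \<longrightarrow>
            (\<forall>U. open_cover_of_sphere n k U \<longrightarrow>
               (\<exists>i<k. contains_antipodally_connecting_path n (U i)))) \<and>
         (int n < 2 * int k - 2 \<longrightarrow>
            (\<exists>U. open_cover_of_sphere n k U \<and>
               (\<forall>i<k. \<not> contains_antipodally_connecting_path n (U i))))"
proof (intro conjI impI allI)
  fix U
  assume n: "n \<ge> 1 \<and> int n \<ge> 2 * int k - 2" and cover: "open_cover_of_sphere n k U"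
  show "\<exists>i<k. contains_antipodally_connecting_path n (U i)"
  proof (rule ccontr)
    assume "\<not> ?thesis"
    then have "n < 2 * (k - 1)"
      using cover_dimension_bound[OF _ cover] n by blast
    with n show False by (cases k) auto
  qed
next
  assume "int n < 2 * int k - 2"
  then obtain d where k: "k = Suc d" and "n < 2 * d" by (cases k) auto
  show "\<exists>U. open_cover_of_sphere n k U \<and>
      (\<forall>i<k. \<not> contains_antipodally_connecting_path n (U i))"
    unfolding k by (rule sharp_cover) fact
qed

end
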